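(* Let $a,b,c$ be nonzero real numbers and let $\epsilon_0,d,m,w$ be positive real numbers. Consider the Benney--Roskes/Zakharov--Rubenchik system $$\begin{aligned} &i\psi_t+a\psi_{xx}+\epsilon_0\psi_{yy}=(b-wm)|\psi|^2\psi-w\,\psi\,\Big\{m\tfrac{\partial}{\partial t}+(mc-d)\tfrac{\partial}{\partial y}\Big\}\varphi,\\ &\varphi_{xx}+(1-mc^2)\varphi_{yy}-m\varphi_{tt}-2mc\,\varphi_{yt}=\Big\{m\tfrac{\partial}{\partial t}+(mc-d)\tfrac{\partial}{\partial y}\Big\}|\psi|^2 \end{aligned}$$ for a complex-valued function $\psi=u+iv$ and a real-valued function $\varphi$ of $(x,y,t)$. Set $$\begin{aligned} &\mathcal X_1=\partial_t,\quad \mathcal X_2=\partial_x,\quad \mathcal X_3=\partial_y,\quad \mathcal X_4=-v\partial_u+u\partial_v+\tfrac{1}{mw}\partial_\varphi,\\ &\mathcal X_5=t(-v\partial_u+u\partial_v)+\tfrac{t}{mw}\partial_\varphi,\quad \mathcal X_6=t^2(-v\partial_u+u\partial_v)+\Big(\tfrac{t^2}{mw}+\tfrac{x^2}{w}\Big)\partial_\varphi . \end{aligned}$$ Then the Lie symmetry (invariance) algebra of the system is infinite-dimensional and is spanned by the following generators. 1. If $m<d^2$: $\mathcal X_1,\dots,\mathcal X_6$ together with all $$\mathcal P_A(F)=F\big(\sqrt{m(d^2-m)}\,x-my+(mc-d)t\big)\partial_\varphi,\qquad \mathcal Q_A(G)=G\big(\sqrt{m(d^2-m)}\,x+my-(mc-d)t\big)\partial_\varphi,$$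 where $F,G$ are arbitrary functions of one variable. 2. If $m>d^2$: $\mathcal X_1,\dots,\mathcal X_6$ together with all $$\mathcal P_B(H)=H(x,\sigma)\,\partial_\varphi,\qquad \sigma=\frac{my-(mc-d)t}{\sqrt{m(m-d^2)}},$$ where $H$ is an arbitrary harmonic function of two variables, $H_{xx}+H_{\sigma\sigma}=0$. 3. If $m=d^2$: $\mathcal X_1,\dots,\mathcal X_6$ together with all $$\mathcal P_C(R)=x\,R\big(dy-(cd-1)t\big)\partial_\varphi,\qquad \mathcal Q_C(S)=S\big(dy-(cd-1)t\big)\partial_\varphi,$$ where $R,S$ are arbitrary functions of one variable.
   Context: The Lie symmetry algebra of a system of PDEs is the Lie algebra (under the commutator of vector fields) of all smooth vector fields on the space of independent and dependent variables, here $(x,y,t,u,v,\varphi)$, that generate local one-parameter groups of point transformations mapping solutions to solutions; equivalently, those whose prolongation annihilates the equations on the solution set (the complex equation being split into its real and imaginary parts with $\psi=u+iv$). Arbitrary functions are assumed smooth. *)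

theory Defs
  imports "HOL-Analysis.Analysis" "HOL-Library.Function_Algebras"
begin

section \<open>Vector spaces of functions\<close>

text \<open>Pointwise real vector space structure, so that \<^const>\<open>span\<close> applies to sets of vector fields.\<close>

instantiation "fun" :: (type, real_vector) real_vector
begin

definition scaleR_fun :: "real \<Rightarrow> ('a \<Rightarrow> 'b) \<Rightarrow> 'a \<Rightarrow> 'b" where
  "scaleR_fun r f = (\<lambda>x. r *\<^sub>R f x)"

instance
  by standard (simp_all add: scaleR_fun_def fun_eq_iff scaleR_add_right scaleR_add_left)

end

definition infinite_dimensional :: "'a::real_vector set \<Rightarrow> bool" where
  "infinite_dimensional L \<longleftrightarrow> \<not> (\<exists>B. finite B \<and> L \<subseteq> span B)"

section \<open>Smooth functions\<close>

primrec C_k :: "nat \<Rightarrow> ('a::euclidean_space \<Rightarrow> 'b::real_normed_vector) \<Rightarrow> bool" where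
  "C_k 0 f \<longleftrightarrow> continuous_on UNIV f"
| "C_k (Suc k) f \<longleftrightarrow> (\<forall>x. f differentiable (at x)) \<and>
     (\<forall>v. C_k k (\<lambda>x. frechet_derivative f (at x) v))"

definition smooth :: "('a::euclidean_space \<Rightarrow> 'b::real_normed_vector) \<Rightarrow> bool" where
  "smooth f \<longleftrightarrow> (\<forall>k. C_k k f)"

definition harmonic :: "(real \<times> real \<Rightarrow> real) \<Rightarrow> bool" where
  "harmonic H \<longleftrightarrow> smooth H \<and>
     (\<forall>x s. deriv (deriv (\<lambda>x'. H (x', s))) x + deriv (deriv (\<lambda>s'. H (x, s'))) s = 0)"

section \<open>Jet spaces and prolongation of vector fields\<close>

text \<open>
  \<open>'i\<close> indexes the independent and \<open>'d\<close> the dependent variables. A point of the second jet space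
  is \<open>((z, p), r)\<close> with \<open>z\<close> the values of the independent and dependent variables,
  \<open>p $ \<alpha> $ i\<close> the derivative \<open>u\<^sup>\<alpha>\<^sub>i\<close> and \<open>r $ \<alpha> $ i $ j\<close> the derivative \<open>u\<^sup>\<alpha>\<^sub>i\<^sub>j\<close>. The type of \<open>r\<close> does not
  enforce \<open>u\<^sup>\<alpha>\<^sub>i\<^sub>j = u\<^sup>\<alpha>\<^sub>j\<^sub>i\<close>; the actual jets are those in \<open>jets2\<close>.
\<close>

type_synonym ('i, 'd) jet0 = "(real^'i) \<times> (real^'d)"
type_synonym ('i, 'd) jet1 = "('i, 'd) jet0 \<times> (real^'i^'d)"
type_synonym ('i, 'd) jet2 = "('i, 'd) jet1 \<times> (real^'i^'i^'d)"
type_synonym ('i, 'd) vfield = "('i, 'd) jet0 \<Rightarrow> ('i, 'd) jet0"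

definition jets2 :: "('i::finite, 'd::finite) jet2 set" where
  "jets2 = {(q, r). \<forall>\<alpha> i j. r $ \<alpha> $ i $ j = r $ \<alpha> $ j $ i}"

text \<open>The total derivatives \<open>D\<^sub>i\<close> of functions on the space of variables and on the first jet space.\<close>

definition total_deriv0 :: "'i \<Rightarrow> (('i::finite, 'd::finite) jet0 \<Rightarrow> real) \<Rightarrow> ('i, 'd) jet1 \<Rightarrow> real" where
  "total_deriv0 i f = (\<lambda>(z, p). frechet_derivative f (at z) (axis i 1, \<chi> \<alpha>. p $ \<alpha> $ i))"

definition total_deriv1 :: "'i \<Rightarrow> (('i::finite, 'd::finite) jet1 \<Rightarrow> real) \<Rightarrow> ('i, 'd) jet2 \<Rightarrow> real" where
  "total_deriv1 i f = (\<lambda>((z, p), r).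
     frechet_derivative f (at (z, p)) ((axis i 1, \<chi> \<alpha>. p $ \<alpha> $ i), \<chi> \<alpha> k. r $ \<alpha> $ k $ i))"

text \<open>
  For \<open>X = \<Sum> \<xi>\<^sup>k \<partial>\<^sub>k + \<Sum> \<eta>\<^sup>\<alpha> \<partial>\<^sub>\<alpha>\<close> the coefficients of the prolongation are given recursively by
  \<open>\<eta>\<^sup>\<alpha>\<^sub>i = D\<^sub>i \<eta>\<^sup>\<alpha> - \<Sum> (D\<^sub>i \<xi>\<^sup>k) u\<^sup>\<alpha>\<^sub>k\<close> and \<open>\<eta>\<^sup>\<alpha>\<^sub>i\<^sub>j = D\<^sub>j \<eta>\<^sup>\<alpha>\<^sub>i - \<Sum> (D\<^sub>j \<xi>\<^sup>k) u\<^sup>\<alpha>\<^sub>i\<^sub>k\<close>, sums over \<open>k\<close>.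
\<close>

definition prolong_coeff1 ::
    "('i::finite, 'd::finite) vfield \<Rightarrow> 'd \<Rightarrow> 'i \<Rightarrow> ('i, 'd) jet1 \<Rightarrow> real" where
  "prolong_coeff1 X \<alpha> i = (\<lambda>(z, p).
     total_deriv0 i (\<lambda>z'. snd (X z') $ \<alpha>) (z, p)
     - (\<Sum>k\<in>UNIV. total_deriv0 i (\<lambda>z'. fst (X z') $ k) (z, p) * p $ \<alpha> $ k))"

definition prolong_coeff2 ::
    "('i::finite, 'd::finite) vfield \<Rightarrow> 'd \<Rightarrow> 'i \<Rightarrow> 'i \<Rightarrow> ('i, 'd) jet2 \<Rightarrow> real" where
  "prolong_coeff2 X \<alpha> i j = (\<lambda>(q, r).
     total_deriv1 j (prolong_coeff1 X \<alpha> i) (q, r)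
     - (\<Sum>k\<in>UNIV. total_deriv0 j (\<lambda>z'. fst (X z') $ k) q * r $ \<alpha> $ i $ k))"

definition prolong2 :: "('i::finite, 'd::finite) vfield \<Rightarrow> ('i, 'd) jet2 \<Rightarrow> ('i, 'd) jet2" where
  "prolong2 X = (\<lambda>((z, p), r).
     ((X z, \<chi> \<alpha> i. prolong_coeff1 X \<alpha> i (z, p)), \<chi> \<alpha> i j. prolong_coeff2 X \<alpha> i j ((z, p), r)))"

text \<open>
  The system is given by a set \<open>\<E>\<close> of left-hand sides \<open>\<Delta>\<close>, with equations \<open>\<Delta> = 0\<close>; the second
  prolongation of \<open>X\<close> has to annihilate every \<open>\<Delta>\<close> on the solution set of the system.
\<close>

definition lie_symmetry_algebra ::
    "(('i::finite, 'd::finite) jet2 \<Rightarrow> real) set \<Rightarrow> ('i, 'd) vfield set" where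
  "lie_symmetry_algebra \<E> = {X. smooth X \<and>
     (\<forall>q\<in>jets2. (\<forall>\<Delta>\<in>\<E>. \<Delta> q = 0) \<longrightarrow>
        (\<forall>\<Delta>\<in>\<E>. frechet_derivative \<Delta> (at q) (prolong2 X q) = 0))}"

section \<open>The Benney--Roskes/Zakharov--Rubenchik system\<close>

datatype indep = Ix | Iy | It
datatype dep = Du | Dv | Dphi

lemma UNIV_indep: "UNIV = {Ix, Iy, It}"
  by (auto intro: indep.exhaust)

lemma UNIV_dep: "UNIV = {Du, Dv, Dphi}"
  by (auto intro: dep.exhaust)

instance indep :: finite
  by standard (simp add: UNIV_indep)

instance dep :: finite
  by standard (simp add: UNIV_dep)

type_synonym brzr_point = "(indep, dep) jet0"
type_synonym brzr_field = "(indep, dep) vfield"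

abbreviation x_of :: "brzr_point \<Rightarrow> real" where "x_of z \<equiv> fst z $ Ix"
abbreviation y_of :: "brzr_point \<Rightarrow> real" where "y_of z \<equiv> fst z $ Iy"
abbreviation t_of :: "brzr_point \<Rightarrow> real" where "t_of z \<equiv> fst z $ It"
abbreviation u_of :: "brzr_point \<Rightarrow> real" where "u_of z \<equiv> snd z $ Du"
abbreviation v_of :: "brzr_point \<Rightarrow> real" where "v_of z \<equiv> snd z $ Dv"

abbreviation psi :: "brzr_point \<Rightarrow> complex" where
  "psi z \<equiv> Complex (u_of z) (v_of z)"

abbreviation psi_1 :: "real^indep^dep \<Rightarrow> indep \<Rightarrow> complex" where
  "psi_1 p i \<equiv> Complex (p $ Du $ i) (p $ Dv $ i)"

abbreviation psi_2 :: "real^indep^indep^dep \<Rightarrow> indep \<Rightarrow> indep \<Rightarrow> complex" where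
  "psi_2 r i j \<equiv> Complex (r $ Du $ i $ j) (r $ Dv $ i $ j)"

definition brzr_eq1 ::
    "real \<Rightarrow> real \<Rightarrow> real \<Rightarrow> real \<Rightarrow> real \<Rightarrow> real \<Rightarrow> real \<Rightarrow> (indep, dep) jet2 \<Rightarrow> complex" where
  "brzr_eq1 a b c \<epsilon>\<^sub>0 d m w = (\<lambda>((z, p), r).
     (\<i> * psi_1 p It + of_real a * psi_2 r Ix Ix + of_real \<epsilon>\<^sub>0 * psi_2 r Iy Iy)
     - (of_real (b - w * m) * of_real ((cmod (psi z))\<^sup>2) * psi z
        - of_real w * psi z * of_real (m * p $ Dphi $ It + (m * c - d) * p $ Dphi $ Iy)))"

definition brzr_eq2 :: "real \<Rightarrow> real \<Rightarrow> real \<Rightarrow> (indep, dep) jet2 \<Rightarrow> real" where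
  "brzr_eq2 c d m = (\<lambda>((z, p), r).
     (r $ Dphi $ Ix $ Ix + (1 - m * c\<^sup>2) * r $ Dphi $ Iy $ Iy
      - m * r $ Dphi $ It $ It - 2 * m * c * r $ Dphi $ Iy $ It)
     - (m * total_deriv0 It (\<lambda>z'. (cmod (psi z'))\<^sup>2) (z, p)
        + (m * c - d) * total_deriv0 Iy (\<lambda>z'. (cmod (psi z'))\<^sup>2) (z, p)))"

definition brzr_system ::
    "real \<Rightarrow> real \<Rightarrow> real \<Rightarrow> real \<Rightarrow> real \<Rightarrow> real \<Rightarrow> real \<Rightarrow> ((indep, dep) jet2 \<Rightarrow> real) set" where
  "brzr_system a b c \<epsilon>\<^sub>0 d m w =
     {\<lambda>q. Re (brzr_eq1 a b c \<epsilon>\<^sub>0 d m w q), \<lambda>q. Im (brzr_eq1 a b c \<epsilon>\<^sub>0 d m w q), brzr_eq2 c d m}"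

section \<open>The generators\<close>

abbreviation pd_x :: brzr_point where "pd_x \<equiv> (axis Ix 1, 0)"
abbreviation pd_y :: brzr_point where "pd_y \<equiv> (axis Iy 1, 0)"
abbreviation pd_t :: brzr_point where "pd_t \<equiv> (axis It 1, 0)"
abbreviation pd_u :: brzr_point where "pd_u \<equiv> (0, axis Du 1)"
abbreviation pd_v :: brzr_point where "pd_v \<equiv> (0, axis Dv 1)"
abbreviation pd_phi :: brzr_point where "pd_phi \<equiv> (0, axis Dphi 1)"

definition \<X>\<^sub>1 :: brzr_field where "\<X>\<^sub>1 = (\<lambda>z. pd_t)"

definition \<X>\<^sub>2 :: brzr_field where "\<X>\<^sub>2 = (\<lambda>z. pd_x)"

definition \<X>\<^sub>3 :: brzr_field where "\<X>\<^sub>3 = (\<lambda>z. pd_y)"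

definition \<X>\<^sub>4 :: "real \<Rightarrow> real \<Rightarrow> brzr_field" where
  "\<X>\<^sub>4 m w = (\<lambda>z. - v_of z *\<^sub>R pd_u + u_of z *\<^sub>R pd_v + (1 / (m * w)) *\<^sub>R pd_phi)"

definition \<X>\<^sub>5 :: "real \<Rightarrow> real \<Rightarrow> brzr_field" where
  "\<X>\<^sub>5 m w = (\<lambda>z. t_of z *\<^sub>R (- v_of z *\<^sub>R pd_u + u_of z *\<^sub>R pd_v)
                 + (t_of z / (m * w)) *\<^sub>R pd_phi)"

definition \<X>\<^sub>6 :: "real \<Rightarrow> real \<Rightarrow> brzr_field" where
  "\<X>\<^sub>6 m w = (\<lambda>z. (t_of z)\<^sup>2 *\<^sub>R (- v_of z *\<^sub>R pd_u + u_of z *\<^sub>R pd_v)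
                 + ((t_of z)\<^sup>2 / (m * w) + (x_of z)\<^sup>2 / w) *\<^sub>R pd_phi)"

definition \<P>\<^sub>A :: "real \<Rightarrow> real \<Rightarrow> real \<Rightarrow> (real \<Rightarrow> real) \<Rightarrow> brzr_field" where
  "\<P>\<^sub>A c d m F = (\<lambda>z.
     F (sqrt (m * (d\<^sup>2 - m)) * x_of z - m * y_of z + (m * c - d) * t_of z) *\<^sub>R pd_phi)"

definition \<Q>\<^sub>A :: "real \<Rightarrow> real \<Rightarrow> real \<Rightarrow> (real \<Rightarrow> real) \<Rightarrow> brzr_field" where
  "\<Q>\<^sub>A c d m G = (\<lambda>z.
     G (sqrt (m * (d\<^sup>2 - m)) * x_of z + m * y_of z - (m * c - d) * t_of z) *\<^sub>R pd_phi)"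

definition \<P>\<^sub>B :: "real \<Rightarrow> real \<Rightarrow> real \<Rightarrow> (real \<times> real \<Rightarrow> real) \<Rightarrow> brzr_field" where
  "\<P>\<^sub>B c d m H = (\<lambda>z.
     H (x_of z, (m * y_of z - (m * c - d) * t_of z) / sqrt (m * (m - d\<^sup>2))) *\<^sub>R pd_phi)"

definition \<P>\<^sub>C :: "real \<Rightarrow> real \<Rightarrow> (real \<Rightarrow> real) \<Rightarrow> brzr_field" where
  "\<P>\<^sub>C c d R = (\<lambda>z. (x_of z * R (d * y_of z - (c * d - 1) * t_of z)) *\<^sub>R pd_phi)"

definition \<Q>\<^sub>C :: "real \<Rightarrow> real \<Rightarrow> (real \<Rightarrow> real) \<Rightarrow> brzr_field" where
  "\<Q>\<^sub>C c d S = (\<lambda>z. S (d * y_of z - (c * d - 1) * t_of z) *\<^sub>R pd_phi)"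

end

theory Submission
  imports Defs
begin

text \<open>
  Jets with equal first derivatives whose second derivatives differ by a solution of the homogeneous
  principal part give conditions on the first derivatives of the coefficients of a symmetry \<open>X\<close>:
  the \<open>\<xi>\<close>'s depend on the independent variables only, and they generate scalings, translations and
  a rotation with a shear in time. The Schroedinger equation scales \<open>t\<close> like \<open>x\<^sup>2\<close>, the wave
  equation scales it like \<open>x\<close>, and the operator \<open>m\<partial>\<^sub>t + (mc - d)\<partial>\<^sub>y\<close> with \<open>d \<noteq> 0\<close> excludes the
  rotation; so only translations remain. Varying the first derivatives then shows that \<open>X\<close> acts on
  \<open>\<psi>\<close> by an infinitesimal phase rotation with rate \<open>B(t)\<close> and on \<open>\<phi>\<close> by a shift \<open>h(x, y, t)\<close>,
  where \<open>w(m h\<^sub>t + (mc - d) h\<^sub>y) = B'\<close> and \<open>h\<close> solves the homogeneous wave equation. As the two operators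
  commute, \<open>B''' = 0\<close>; this gives \<open>\<X>\<^sub>4, \<X>\<^sub>5, \<X>\<^sub>6\<close>. What is left of \<open>h\<close> is a function of \<open>x\<close> and
  \<open>s = my - (mc - d)t\<close> with \<open>h\<^sub>x\<^sub>x + m(m - d\<^sup>2)h\<^sub>s\<^sub>s = 0\<close>, which is hyperbolic, elliptic
  or degenerate according to the sign of \<open>m - d\<^sup>2\<close>.
\<close>

section \<open>Calculus of smooth functions\<close>

text \<open>The determining equations of an arbitrary symmetry are never expanded as a whole. Each
  condition comes from comparing two explicit jets over the same point: every equation can be solved
  for an xx-derivative with nonzero coefficient (\<open>base_jet\<close>), so the first derivatives
  and the remaining second derivatives are free, and a change in one of them is balanced, where
  necessary, in other entries. Subtracting the two instances leaves one short relation between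
  derivatives of the coefficients. The products of psi with phi_t and phi_y and the quadratic
  right-hand side put factors u and v into several of these relations, which then say nothing where
  the factor vanishes. The coefficient in question is first shown not to depend on u, and this
  carries the conclusion over to u = 0 (\<open>zero_off_hyperplane\<close>). Infinite dimension is
  tested on shifts of phi whose values along a path are exp(k s), with k a natural number.\<close>

definition dirderiv :: "'a \<Rightarrow> ('a::euclidean_space \<Rightarrow> 'b::real_normed_vector) \<Rightarrow> 'a \<Rightarrow> 'b" where
  "dirderiv v f z = frechet_derivative f (at z) v"

lemma dirderiv_eqI: "(f has_derivative f') (at z) \<Longrightarrow> dirderiv v f z = f' v"
  unfolding dirderiv_def using frechet_derivative_at by metis

lemma C_k_Suc_imp: "C_k (Suc k) f \<Longrightarrow> C_k k f"
proof (induction k arbitrary: f)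
  case 0
  then show ?case
    by (auto intro!: continuous_at_imp_continuous_on differentiable_imp_continuous_within)
next
  case (Suc k)
  from Suc.prems have f: "f differentiable (at x)" "C_k (Suc k) (\<lambda>x. frechet_derivative f (at x) v)" for x v
    unfolding C_k.simps(2)[of "Suc k" f] by auto
  show ?case
    unfolding C_k.simps(2)[of k f] using f(1) Suc.IH[OF f(2)] by blast
qed

lemma smooth_differentiable: "smooth f \<Longrightarrow> f differentiable (at x)"
  unfolding smooth_def using C_k.simps(2)[of 0 f] by blast

lemma smooth_dirderiv: "smooth f \<Longrightarrow> smooth (dirderiv v f)"
  unfolding smooth_def dirderiv_def[abs_def] using C_k.simps(2)[of _ f] by blast

lemma smooth_has_derivative: "smooth f \<Longrightarrow> (f has_derivative (\<lambda>v. dirderiv v f z)) (at z)"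
  unfolding dirderiv_def using smooth_differentiable frechet_derivative_works by blast

lemma smooth_continuous: "smooth f \<Longrightarrow> continuous_on UNIV f"
  unfolding smooth_def using C_k.simps(1)[of f] by blast

text \<open>A family closed under all directional derivatives lies in every \<open>C_k\<close>, by
  induction on \<open>k\<close>. For families such as A exp(\<kappa> s) this avoids a formula for
  the k-th derivative.\<close>

lemma smooth_coinduct:
  assumes "P f"
    and step: "\<And>g. P g \<Longrightarrow> (\<forall>x. g differentiable (at x)) \<and> (\<forall>v. P (dirderiv v g))"
  shows "smooth f"
proof -
  have "P g \<Longrightarrow> C_k k g" for k g
  proof (induction k arbitrary: g)
    case 0
    then show ?case
      using step by (auto intro!: continuous_at_imp_continuous_on differentiable_imp_continuous_within)
  next
    case (Suc k)
    then show ?case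
      using step[of g] unfolding dirderiv_def[abs_def] by simp
  qed
  then show ?thesis
    using \<open>P f\<close> unfolding smooth_def by blast
qed

lemma dirderiv_const [simp]: "dirderiv v (\<lambda>x. c) = (\<lambda>x. 0)"
  by (simp add: dirderiv_def fun_eq_iff)

lemma smooth_const [simp]: "smooth (\<lambda>x. c)"
proof (rule smooth_coinduct[where P = "\<lambda>f. \<exists>c. f = (\<lambda>x. c)"])
  fix g :: "'a \<Rightarrow> 'b"
  assume "\<exists>c. g = (\<lambda>x. c)"
  then show "(\<forall>x. g differentiable (at x)) \<and> (\<forall>v. \<exists>c. dirderiv v g = (\<lambda>x. c))"
    by auto
qed auto

text \<open>An affine map inside and a linear map outside: components of vector-valued functions,
  pull-backs along linear maps and translations are all instances.\<close>

lemma has_derivative_linear_compose: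
  assumes "smooth f" "bounded_linear L" "bounded_linear A"
  shows "((\<lambda>x. L (f (A x + b))) has_derivative (\<lambda>v. L (dirderiv (A v) f (A z + b)))) (at z)"
proof -
  have "((\<lambda>x. A x + b) has_derivative A) (at z)"
    using has_derivative_add[OF bounded_linear_imp_has_derivative[OF assms(3)] has_derivative_const[of b]]
    by simp
  then have "((\<lambda>x. f (A x + b)) has_derivative (\<lambda>v. dirderiv (A v) f (A z + b))) (at z)"
    using has_derivative_compose smooth_has_derivative[OF assms(1)] by blast
  then show ?thesis
    using bounded_linear.has_derivative[OF assms(2)] by blast
qed

lemma dirderiv_linear_compose:
  assumes "smooth f" "bounded_linear L" "bounded_linear A"
  shows "dirderiv v (\<lambda>x. L (f (A x + b))) = (\<lambda>x. L (dirderiv (A v) f (A x + b)))"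
  using dirderiv_eqI[OF has_derivative_linear_compose[OF assms]] by (simp add: fun_eq_iff)

lemma smooth_linear_compose:
  assumes "smooth f" "bounded_linear L" "bounded_linear A"
  shows "smooth (\<lambda>x. L (f (A x + b)))"
proof (rule smooth_coinduct[where P = "\<lambda>g. \<exists>f. smooth f \<and> g = (\<lambda>x. L (f (A x + b)))"])
  fix g assume "\<exists>f. smooth f \<and> g = (\<lambda>x. L (f (A x + b)))"
  then obtain f where f: "smooth f" "g = (\<lambda>x. L (f (A x + b)))" by blast
  have "g differentiable at x" for x
    unfolding f(2) by (rule differentiableI[OF has_derivative_linear_compose[OF f(1) assms(2,3)]])
  then show "(\<forall>x. g differentiable at x) \<and>
         (\<forall>v. \<exists>f. smooth f \<and> dirderiv v g = (\<lambda>x. L (f (A x + b))))"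
    unfolding f(2) dirderiv_linear_compose[OF f(1) assms(2,3)] using smooth_dirderiv[OF f(1)] by blast
qed (use assms in blast)

lemmas smooth_bounded_linear_comp =
  smooth_linear_compose[OF _ _ bounded_linear_ident, where b = 0, simplified]
lemmas smooth_comp_bounded_linear =
  smooth_linear_compose[OF _ bounded_linear_ident, where b = 0, simplified]
lemmas dirderiv_bounded_linear_comp =
  dirderiv_linear_compose[OF _ _ bounded_linear_ident, where b = 0, simplified]
lemmas dirderiv_comp_bounded_linear =
  dirderiv_linear_compose[OF _ bounded_linear_ident, where b = 0, simplified]

lemma dirderiv_add:
  assumes "smooth f" "smooth g"
  shows "dirderiv v (\<lambda>x. f x + g x) = (\<lambda>x. dirderiv v f x + dirderiv v g x)"
  using dirderiv_eqI[OF has_derivative_add[OF assms[THEN smooth_has_derivative]]]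
  by (simp add: fun_eq_iff)

lemma smooth_add:
  assumes "smooth f" "smooth g"
  shows "smooth (\<lambda>x. f x + g x)"
proof (rule smooth_coinduct[where P = "\<lambda>h. \<exists>f g. smooth f \<and> smooth g \<and> h = (\<lambda>x. f x + g x)"])
  fix h :: "'a \<Rightarrow> 'b" assume "\<exists>f g. smooth f \<and> smooth g \<and> h = (\<lambda>x. f x + g x)"
  then obtain f g where h: "smooth f" "smooth g" "h = (\<lambda>x. f x + g x)" by blast
  show "(\<forall>x. h differentiable at x) \<and>
         (\<forall>v. \<exists>f g. smooth f \<and> smooth g \<and> dirderiv v h = (\<lambda>x. f x + g x))"
    unfolding h(3) dirderiv_add[OF h(1,2)]
    using smooth_dirderiv[OF h(1)] smooth_dirderiv[OF h(2)]
    by (blast intro: differentiable_add smooth_differentiable h(1,2))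
qed (use assms in blast)

lemma dirderiv_scaleR:
  fixes f :: "'a::euclidean_space \<Rightarrow> real"
  assumes "smooth f" "smooth g"
  shows "dirderiv v (\<lambda>x. f x *\<^sub>R g x) = (\<lambda>x. dirderiv v f x *\<^sub>R g x + f x *\<^sub>R dirderiv v g x)"
  using dirderiv_eqI[OF has_derivative_scaleR[OF assms[THEN smooth_has_derivative]]]
  by (simp add: fun_eq_iff add.commute)

lemma C_k_add:
  assumes "C_k k f" "C_k k g"
  shows "C_k k (\<lambda>x. f x + g x)"
  using assms
proof (induction k arbitrary: f g)
  case (Suc k)
  have f: "(f has_derivative frechet_derivative f (at x)) (at x)"
    and g: "(g has_derivative frechet_derivative g (at x)) (at x)" for x
    using Suc.prems unfolding C_k.simps frechet_derivative_works by blast+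
  have "frechet_derivative (\<lambda>x. f x + g x) (at x) =
      (\<lambda>v. frechet_derivative f (at x) v + frechet_derivative g (at x) v)" for x
    using frechet_derivative_at[OF has_derivative_add[OF f g]] by simp
  then show ?case
    using Suc by simp
qed (auto intro: continuous_on_add)

text \<open>By induction on \<open>k\<close> and not by \<open>smooth_coinduct\<close>: the
  derivative of a product is a sum of two products, so products alone are not closed under
  differentiation. \<open>C_k_Suc_imp\<close> handles the undifferentiated factor.\<close>

lemma C_k_scaleR:
  fixes f :: "'a::euclidean_space \<Rightarrow> real"
  assumes "C_k k f" "C_k k g"
  shows "C_k k (\<lambda>x. f x *\<^sub>R g x)"
  using assms
proof (induction k arbitrary: f g)
  case (Suc k)
  have f: "(f has_derivative frechet_derivative f (at x)) (at x)"
    and g: "(g has_derivative frechet_derivative g (at x)) (at x)" for x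
    using Suc.prems unfolding C_k.simps frechet_derivative_works by blast+
  have "frechet_derivative (\<lambda>x. f x *\<^sub>R g x) (at x) =
      (\<lambda>v. f x *\<^sub>R frechet_derivative g (at x) v + frechet_derivative f (at x) v *\<^sub>R g x)" for x
    using frechet_derivative_at[OF has_derivative_scaleR[OF f g]] by simp
  moreover have "C_k k f" "C_k k g"
    using Suc.prems C_k_Suc_imp by blast+
  ultimately show ?case
    using Suc.prems by (auto intro!: C_k_add Suc.IH)
qed (auto intro: continuous_on_scaleR)

lemma smooth_scaleR:
  fixes f :: "'a::euclidean_space \<Rightarrow> real"
  shows "smooth f \<Longrightarrow> smooth g \<Longrightarrow> smooth (\<lambda>x. f x *\<^sub>R g x)"
  unfolding smooth_def using C_k_scaleR by blast

lemmas smooth_mult = smooth_scaleR[where 'b = real, simplified]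
lemmas dirderiv_mult = dirderiv_scaleR[where 'b = real, simplified]

lemma dirderiv_bounded_linear: "bounded_linear f \<Longrightarrow> dirderiv v f = (\<lambda>z. f v)"
  by (rule ext) (rule dirderiv_eqI[OF bounded_linear_imp_has_derivative])

lemma smooth_bounded_linear:
  assumes "bounded_linear f"
  shows "smooth f"
\<comment> \<open>The derivative of a linear map is a constant function, which is linear only if it
  vanishes; hence the second disjunct.\<close>
proof (rule smooth_coinduct[where P = "\<lambda>g. bounded_linear g \<or> smooth g"])
  fix g :: "'a \<Rightarrow> 'b" assume "bounded_linear g \<or> smooth g"
  then show "(\<forall>x. g differentiable at x) \<and>
      (\<forall>v. bounded_linear (dirderiv v g) \<or> smooth (dirderiv v g))"
  proof
    assume g: "bounded_linear g"
    then have "g differentiable at x" for x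
      using bounded_linear_imp_has_derivative differentiableI by blast
    then show ?thesis
      unfolding dirderiv_bounded_linear[OF g] by simp
  qed (simp add: smooth_differentiable smooth_dirderiv)
qed (use assms in simp)

lemma linear_dirderiv: "smooth f \<Longrightarrow> linear (\<lambda>v. dirderiv v f z)"
  unfolding dirderiv_def by (rule linear_frechet_derivative[OF smooth_differentiable])

lemma dirderiv_along_line:
  assumes "smooth f"
  shows "((\<lambda>s. f (z + s *\<^sub>R v)) has_vector_derivative dirderiv v f (z + s *\<^sub>R v)) (at s)"
proof -
  have "((\<lambda>s. z + s *\<^sub>R v) has_derivative (\<lambda>r. r *\<^sub>R v)) (at s)"
    by (auto intro!: derivative_eq_intros)
  from has_derivative_compose[OF this smooth_has_derivative[OF assms]]
  show ?thesis
    unfolding has_vector_derivative_def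
    by (simp add: linear_cmul[OF linear_dirderiv[OF assms]])
qed

lemma constant_along:
  assumes "smooth f" "\<And>z. dirderiv v f z = 0"
  shows "f (z + s *\<^sub>R v) = f z"
proof -
  have "((\<lambda>s. f (z + s *\<^sub>R v)) has_derivative (\<lambda>h. 0)) (at r)" for r
    using dirderiv_along_line[OF assms(1), of z v r] assms(2) by (simp add: has_vector_derivative_def)
  from has_derivative_zero_unique[of UNIV "\<lambda>s. f (z + s *\<^sub>R v)" s 0, OF _ this]
  show ?thesis by simp
qed

text \<open>The mean value theorem twice: along \<open>a\<close> for the difference of two parallel
  slices, then along \<open>b\<close>. The left-hand side is symmetric in \<open>a\<close> and
  \<open>b\<close>, the right-hand side is not.\<close>

lemma second_difference:
  fixes f :: "'a::euclidean_space \<Rightarrow> real"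
  assumes "smooth f" "h > 0"
  shows "\<exists>s t. 0 < s \<and> s < h \<and> 0 < t \<and> t < h \<and>
    f (z + h *\<^sub>R a + h *\<^sub>R b) - f (z + h *\<^sub>R a) - f (z + h *\<^sub>R b) + f z
      = h * h * dirderiv b (dirderiv a f) (z + s *\<^sub>R a + t *\<^sub>R b)"
proof -
  define g where "g s = f (z + h *\<^sub>R b + s *\<^sub>R a) - f (z + s *\<^sub>R a)" for s
  have g': "(g has_real_derivative (dirderiv a f (z + h *\<^sub>R b + s *\<^sub>R a) - dirderiv a f (z + s *\<^sub>R a))) (at s)" for s
    unfolding g_def has_real_derivative_iff_has_vector_derivative
    by (intro has_vector_derivative_diff dirderiv_along_line assms)
  obtain s where s: "0 < s" "s < h"
    "g h - g 0 = (h - 0) * (dirderiv a f (z + h *\<^sub>R b + s *\<^sub>R a) - dirderiv a f (z + s *\<^sub>R a))"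
    using MVT2[OF assms(2) g'] by blast
  define k where "k t = dirderiv a f (z + s *\<^sub>R a + t *\<^sub>R b)" for t
  have k': "(k has_real_derivative dirderiv b (dirderiv a f) (z + s *\<^sub>R a + t *\<^sub>R b)) (at t)" for t
    unfolding k_def has_real_derivative_iff_has_vector_derivative
    by (intro dirderiv_along_line smooth_dirderiv assms)
  obtain t where t: "0 < t" "t < h"
    "k h - k 0 = (h - 0) * dirderiv b (dirderiv a f) (z + s *\<^sub>R a + t *\<^sub>R b)"
    using MVT2[OF assms(2) k'] by blast
  have "f (z + h *\<^sub>R a + h *\<^sub>R b) - f (z + h *\<^sub>R a) - f (z + h *\<^sub>R b) + f z = g h - g 0"
    unfolding g_def by (simp add: algebra_simps)
  also have "\<dots> = h * (k h - k 0)"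
    using s(3) unfolding k_def by (simp add: algebra_simps)
  finally show ?thesis
    using s t by auto
qed

text \<open>By \<open>second_difference\<close> the two mixed derivatives, taken at suitable points
  near \<open>z\<close>, have the same value. Both are continuous, so they agree at \<open>z\<close>
  itself.\<close>

lemma dirderiv_commute:
  fixes f :: "'a::euclidean_space \<Rightarrow> real"
  assumes "smooth f"
  shows "dirderiv a (dirderiv b f) = dirderiv b (dirderiv a f)"
proof
  fix z
  have near: "\<exists>\<delta>>0. \<forall>s t. 0 < s \<and> s < \<delta> \<and> 0 < t \<and> t < \<delta> \<longrightarrow>
      \<bar>dirderiv b (dirderiv a f) (z + s *\<^sub>R a + t *\<^sub>R b) - dirderiv b (dirderiv a f) z\<bar> < e"
    if "e > 0" for e a b
  proof -
    let ?F = "dirderiv b (dirderiv a f)"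
    have "continuous_on UNIV ?F"
      using assms smooth_continuous smooth_dirderiv by blast
    then obtain r where r: "r > 0" "\<And>y. dist y z < r \<Longrightarrow> dist (?F y) (?F z) < e"
      using \<open>e > 0\<close> unfolding continuous_on_iff by (metis UNIV_I)
    \<comment> \<open>With this bound on s and t the point stays within distance r of z; the summand
      1 covers a = b = 0.\<close>
    define \<delta> where "\<delta> = r / (norm a + norm b + 1)"
    have "\<delta> > 0"
      unfolding \<delta>_def using r(1) by (simp add: add_nonneg_pos)
    moreover have "dist (?F (z + s *\<^sub>R a + t *\<^sub>R b)) (?F z) < e"
      if "0 < s" "s < \<delta>" "0 < t" "t < \<delta>" for s t
    proof (rule r(2))
      have "dist (z + s *\<^sub>R a + t *\<^sub>R b) z = norm (s *\<^sub>R a + t *\<^sub>R b)"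
        by (simp add: dist_norm)
      also have "\<dots> \<le> s * norm a + t * norm b"
        using norm_triangle_ineq[of "s *\<^sub>R a" "t *\<^sub>R b"] that by simp
      also have "\<dots> \<le> \<delta> * norm a + \<delta> * norm b"
        using that by (intro add_mono mult_right_mono) auto
      also have "\<dots> < \<delta> * (norm a + norm b + 1)"
        using \<open>\<delta> > 0\<close> by (simp add: algebra_simps)
      also have "\<dots> = r"
        unfolding \<delta>_def by (simp add: add_nonneg_pos pos_add_strict less_imp_neq[THEN not_sym])
      finally show "dist (z + s *\<^sub>R a + t *\<^sub>R b) z < r" .
    qed
    ultimately show ?thesis
      by (auto simp: dist_real_def)
  qed
  show "dirderiv a (dirderiv b f) z = dirderiv b (dirderiv a f) z"
  proof (rule ccontr)
    assume ne: "dirderiv a (dirderiv b f) z \<noteq> dirderiv b (dirderiv a f) z"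
    define e where "e = \<bar>dirderiv a (dirderiv b f) z - dirderiv b (dirderiv a f) z\<bar> / 2"
    have "e > 0"
      using ne by (simp add: e_def)
    obtain \<delta>1 where 1: "\<delta>1 > 0" "\<And>s t. 0 < s \<Longrightarrow> s < \<delta>1 \<Longrightarrow> 0 < t \<Longrightarrow> t < \<delta>1 \<Longrightarrow>
      \<bar>dirderiv b (dirderiv a f) (z + s *\<^sub>R a + t *\<^sub>R b) - dirderiv b (dirderiv a f) z\<bar> < e"
      using near[OF \<open>e > 0\<close>] by blast
    obtain \<delta>2 where 2: "\<delta>2 > 0" "\<And>s t. 0 < s \<Longrightarrow> s < \<delta>2 \<Longrightarrow> 0 < t \<Longrightarrow> t < \<delta>2 \<Longrightarrow>
      \<bar>dirderiv a (dirderiv b f) (z + s *\<^sub>R b + t *\<^sub>R a) - dirderiv a (dirderiv b f) z\<bar> < e"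
      using near[OF \<open>e > 0\<close>] by blast
    define h where "h = min \<delta>1 \<delta>2"
    have h: "h > 0" "h \<le> \<delta>1" "h \<le> \<delta>2"
      using 1 2 by (auto simp: h_def)
    obtain s t where st: "0 < s" "s < h" "0 < t" "t < h"
      "f (z + h *\<^sub>R a + h *\<^sub>R b) - f (z + h *\<^sub>R a) - f (z + h *\<^sub>R b) + f z
        = h * h * dirderiv b (dirderiv a f) (z + s *\<^sub>R a + t *\<^sub>R b)"
      using second_difference[OF assms h(1)] by metis
    obtain s' t' where st': "0 < s'" "s' < h" "0 < t'" "t' < h"
      "f (z + h *\<^sub>R b + h *\<^sub>R a) - f (z + h *\<^sub>R b) - f (z + h *\<^sub>R a) + f z
        = h * h * dirderiv a (dirderiv b f) (z + s' *\<^sub>R b + t' *\<^sub>R a)"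
      using second_difference[OF assms h(1)] by metis
    have "h * h * dirderiv b (dirderiv a f) (z + s *\<^sub>R a + t *\<^sub>R b)
        = h * h * dirderiv a (dirderiv b f) (z + s' *\<^sub>R b + t' *\<^sub>R a)"
      using st(5) st'(5) by (simp add: algebra_simps)
    then have "dirderiv b (dirderiv a f) (z + s *\<^sub>R a + t *\<^sub>R b)
        = dirderiv a (dirderiv b f) (z + s' *\<^sub>R b + t' *\<^sub>R a)"
      using h(1) by simp
    moreover have "\<bar>dirderiv b (dirderiv a f) (z + s *\<^sub>R a + t *\<^sub>R b) - dirderiv b (dirderiv a f) z\<bar> < e"
      using 1 st h by auto
    moreover have "\<bar>dirderiv a (dirderiv b f) (z + s' *\<^sub>R b + t' *\<^sub>R a) - dirderiv a (dirderiv b f) z\<bar> < e"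
      using 2 st' h by auto
    ultimately have "\<bar>dirderiv a (dirderiv b f) z - dirderiv b (dirderiv a f) z\<bar> < e + e"
      by linarith
    then show False
      by (simp add: e_def)
  qed
qed

section \<open>The second prolongation in coordinates\<close>

definition d_indep :: "'i \<Rightarrow> (('i::finite, 'd::finite) jet0 \<Rightarrow> real) \<Rightarrow> ('i, 'd) jet0 \<Rightarrow> real" where
  "d_indep i = dirderiv (axis i 1, 0)"

definition d_dep :: "'d \<Rightarrow> (('i::finite, 'd::finite) jet0 \<Rightarrow> real) \<Rightarrow> ('i, 'd) jet0 \<Rightarrow> real" where
  "d_dep \<alpha> = dirderiv (0, axis \<alpha> 1)"

lemma smooth_d_indep: "smooth f \<Longrightarrow> smooth (d_indep i f)"
  by (simp add: d_indep_def smooth_dirderiv)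

lemma smooth_d_dep: "smooth f \<Longrightarrow> smooth (d_dep i f)"
  by (simp add: d_dep_def smooth_dirderiv)

lemma vec_expand: "(x :: real^'n) = (\<Sum>i\<in>UNIV. x $ i *\<^sub>R axis i 1)"
  by (simp add: vec_eq_iff sum_component axis_def if_distrib cong: if_cong)

lemma dirderiv_expand:
  fixes f :: "('i::finite, 'd::finite) jet0 \<Rightarrow> real"
  assumes "smooth f"
  shows "dirderiv v f z = (\<Sum>i\<in>UNIV. fst v $ i * d_indep i f z) + (\<Sum>\<alpha>\<in>UNIV. snd v $ \<alpha> * d_dep \<alpha> f z)"
proof -
  interpret D: linear "\<lambda>v. dirderiv v f z"
    by (rule linear_dirderiv[OF assms])
  have "v = (\<Sum>i\<in>UNIV. fst v $ i *\<^sub>R (axis i 1, 0)) + (\<Sum>\<alpha>\<in>UNIV. snd v $ \<alpha> *\<^sub>R (0, axis \<alpha> 1))"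
    using vec_expand[of "fst v"] vec_expand[of "snd v"]
    by (simp add: prod_eq_iff fst_sum snd_sum)
  then have "dirderiv v f z = dirderiv ((\<Sum>i\<in>UNIV. fst v $ i *\<^sub>R (axis i 1, 0)) + (\<Sum>\<alpha>\<in>UNIV. snd v $ \<alpha> *\<^sub>R (0, axis \<alpha> 1))) f z"
    by simp
  also have "\<dots> = (\<Sum>i\<in>UNIV. fst v $ i * d_indep i f z) + (\<Sum>\<alpha>\<in>UNIV. snd v $ \<alpha> * d_dep \<alpha> f z)"
    by (simp only: D.add D.sum D.scaleR d_indep_def d_dep_def real_scaleR_def)
  finally show ?thesis .
qed

lemma total_deriv0_dirderiv:
  "total_deriv0 i f (z, p) = dirderiv (axis i 1, \<chi> \<alpha>. p $ \<alpha> $ i) f z"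
  by (simp add: total_deriv0_def dirderiv_def)

lemma total_deriv0_eq:
  fixes f :: "('i::finite, 'd::finite) jet0 \<Rightarrow> real"
  assumes "smooth f"
  shows "total_deriv0 i f (z, p) = d_indep i f z + (\<Sum>\<alpha>\<in>UNIV. p $ \<alpha> $ i * d_dep \<alpha> f z)"
  unfolding total_deriv0_dirderiv dirderiv_expand[OF assms]
  by (simp add: axis_def if_distrib[of "\<lambda>x. x * _"] cong: if_cong)

lemma total_deriv0_const [simp]: "total_deriv0 i (\<lambda>z. c) = (\<lambda>q. 0)"
  by (auto simp: total_deriv0_def)

text \<open>The iterated total derivative \<open>D\<^sub>j (D\<^sub>i f)\<close>.\<close>

definition total_deriv2 ::
    "'i \<Rightarrow> 'i \<Rightarrow> (('i::finite, 'd::finite) jet0 \<Rightarrow> real) \<Rightarrow> ('i, 'd) jet2 \<Rightarrow> real" where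
  "total_deriv2 i j f = (\<lambda>((z, p), r). total_deriv0 j (d_indep i f) (z, p)
     + (\<Sum>\<beta>\<in>UNIV. r $ \<beta> $ i $ j * d_dep \<beta> f z + p $ \<beta> $ i * total_deriv0 j (d_dep \<beta> f) (z, p)))"

lemmas has_derivative_vec_nth [derivative_intros] = bounded_linear.has_derivative[OF bounded_linear_vec_nth]

lemma has_derivative_comp_fst:
  fixes f :: "('i::finite, 'd::finite) jet0 \<Rightarrow> real"
  assumes "smooth f"
  shows "((\<lambda>q. f (fst q)) has_derivative (\<lambda>h. dirderiv (fst h) f (fst q))) (at q)"
  by (rule has_derivative_compose[OF has_derivative_fst[OF has_derivative_ident] smooth_has_derivative[OF assms]])

lemma has_derivative_total_deriv0:
  fixes f :: "('i::finite, 'd::finite) jet0 \<Rightarrow> real"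
  assumes "smooth f"
  shows "(total_deriv0 i f has_derivative (\<lambda>h. dirderiv (fst h) (d_indep i f) (fst q)
    + (\<Sum>\<alpha>\<in>UNIV. snd h $ \<alpha> $ i * d_dep \<alpha> f (fst q) + snd q $ \<alpha> $ i * dirderiv (fst h) (d_dep \<alpha> f) (fst q)))) (at q)"
proof -
  have eq: "total_deriv0 i f = (\<lambda>q. d_indep i f (fst q) + (\<Sum>\<alpha>\<in>UNIV. snd q $ \<alpha> $ i * d_dep \<alpha> f (fst q)))"
    using total_deriv0_eq[OF assms] by auto
  show ?thesis
    unfolding eq
    by (auto intro!: derivative_eq_intros has_derivative_comp_fst smooth_d_indep smooth_d_dep assms
        simp: fun_eq_iff intro!: sum.cong)
qed

lemma prolong_coeff1_conv:
  "prolong_coeff1 X \<alpha> i = (\<lambda>q. total_deriv0 i (\<lambda>z'. snd (X z') $ \<alpha>) q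
     - (\<Sum>k\<in>UNIV. total_deriv0 i (\<lambda>z'. fst (X z') $ k) q * snd q $ \<alpha> $ k))"
  by (auto simp: prolong_coeff1_def)

lemma smooth_components:
  fixes X :: "('i::finite, 'd::finite) vfield"
  assumes "smooth X"
  shows "smooth (\<lambda>z. fst (X z) $ k)" "smooth (\<lambda>z. snd (X z) $ \<alpha>)"
proof -
  have "bounded_linear (\<lambda>z::('i, 'd) jet0. fst z $ k)" "bounded_linear (\<lambda>z::('i, 'd) jet0. snd z $ \<alpha>)"
    by (intro bounded_linear_compose[OF bounded_linear_vec_nth] bounded_linear_fst bounded_linear_snd)+
  then show "smooth (\<lambda>z. fst (X z) $ k)" "smooth (\<lambda>z. snd (X z) $ \<alpha>)"
    using smooth_bounded_linear_comp[OF assms] by blast+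
qed

text \<open>The coefficient is defined through a Frechet derivative on the first jet space. Carried
  out here once for every field, it leaves only partial derivatives of the components of
  \<open>X\<close> on the space of variables.\<close>

lemma prolong_coeff2_eq:
  fixes X :: "('i::finite, 'd::finite) vfield"
  assumes "smooth X"
  shows "prolong_coeff2 X \<alpha> i j ((z, p), r) =
    total_deriv2 i j (\<lambda>z. snd (X z) $ \<alpha>) ((z, p), r)
    - (\<Sum>k\<in>UNIV. r $ \<alpha> $ k $ j * total_deriv0 i (\<lambda>z. fst (X z) $ k) (z, p)
        + p $ \<alpha> $ k * total_deriv2 i j (\<lambda>z. fst (X z) $ k) ((z, p), r)
        + r $ \<alpha> $ i $ k * total_deriv0 j (\<lambda>z. fst (X z) $ k) (z, p))"
proof -
  note td = has_derivative_total_deriv0[OF smooth_components(2)[OF assms]]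
    has_derivative_total_deriv0[OF smooth_components(1)[OF assms]]
  have "(prolong_coeff1 X \<alpha> i has_derivative (\<lambda>h.
     (dirderiv (fst h) (d_indep i (\<lambda>z. snd (X z) $ \<alpha>)) z
    + (\<Sum>\<beta>\<in>UNIV. snd h $ \<beta> $ i * d_dep \<beta> (\<lambda>z. snd (X z) $ \<alpha>) z
        + p $ \<beta> $ i * dirderiv (fst h) (d_dep \<beta> (\<lambda>z. snd (X z) $ \<alpha>)) z))
    - (\<Sum>k\<in>UNIV. total_deriv0 i (\<lambda>z. fst (X z) $ k) (z, p) * snd h $ \<alpha> $ k
        + (dirderiv (fst h) (d_indep i (\<lambda>z. fst (X z) $ k)) z
          + (\<Sum>\<beta>\<in>UNIV. snd h $ \<beta> $ i * d_dep \<beta> (\<lambda>z. fst (X z) $ k) z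
            + p $ \<beta> $ i * dirderiv (fst h) (d_dep \<beta> (\<lambda>z. fst (X z) $ k)) z)) * p $ \<alpha> $ k))) (at (z, p))"
    unfolding prolong_coeff1_conv
    by (auto intro!: derivative_eq_intros td simp: fun_eq_iff)
  from dirderiv_eqI[OF this, of "((axis j 1, \<chi> \<alpha>. p $ \<alpha> $ j), \<chi> \<alpha> k. r $ \<alpha> $ k $ j)"]
  show ?thesis
    unfolding prolong_coeff2_def total_deriv1_def total_deriv2_def
    by (simp add: dirderiv_def[symmetric] total_deriv0_dirderiv[symmetric] sum.distrib algebra_simps)
qed

section \<open>Determining equations of the system\<close>

lemma sum_indep: "(\<Sum>k\<in>UNIV. f k) = f Ix + f Iy + f It"
  by (simp add: UNIV_indep add.assoc)

lemma sum_dep: "(\<Sum>k\<in>UNIV. f k) = f Du + f Dv + f Dphi"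
  by (simp add: UNIV_dep add.assoc)

abbreviation xi :: "brzr_field \<Rightarrow> indep \<Rightarrow> brzr_point \<Rightarrow> real" where
  "xi X k \<equiv> \<lambda>z. fst (X z) $ k"

abbreviation eta :: "brzr_field \<Rightarrow> dep \<Rightarrow> brzr_point \<Rightarrow> real" where
  "eta X \<alpha> \<equiv> \<lambda>z. snd (X z) $ \<alpha>"

lemma frechet_derivative_eqI:
  "(f has_derivative f') (at z) \<Longrightarrow> frechet_derivative f (at z) v = f' v"
  by (drule frechet_derivative_at) simp

lemma frechet_derivative_sq_psi:
  "frechet_derivative (\<lambda>z. (cmod (psi z))\<^sup>2) (at z) h = 2 * u_of z * u_of h + 2 * v_of z * v_of h"
proof -
  have "((\<lambda>z. (cmod (psi z))\<^sup>2) has_derivative (\<lambda>h. 2 * u_of z * u_of h + 2 * v_of z * v_of h)) (at z)"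
  proof -
    have "((\<lambda>z::brzr_point. snd z $ \<alpha>) has_derivative (\<lambda>h. snd h $ \<alpha>)) (at z)" for \<alpha>
      by (intro has_derivative_vec_nth has_derivative_snd has_derivative_ident)
    from has_derivative_add[OF has_derivative_power[OF this[of Du], of 2] has_derivative_power[OF this[of Dv], of 2]]
    show ?thesis
      unfolding cmod_power2 complex.sel by (simp add: mult_ac)
  qed
  then show ?thesis
    by (rule frechet_derivative_eqI)
qed

definition symmetric_jet :: "real^'i^'i^'d \<Rightarrow> bool" where
  "symmetric_jet s \<longleftrightarrow> (\<forall>\<alpha> i j. s $ \<alpha> $ i $ j = s $ \<alpha> $ j $ i)"

section \<open>The system as three real equations on jets, and their differentials\<close>

locale brzr =
  fixes a b c \<epsilon>\<^sub>0 d m w :: real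
  assumes a: "a \<noteq> 0" and eps: "\<epsilon>\<^sub>0 > 0" and d: "d > 0" and m: "m > 0" and w: "w > 0"
begin

definition E\<^sub>1 :: "brzr_point \<Rightarrow> real^indep^dep \<Rightarrow> real^indep^indep^dep \<Rightarrow> real" where
  "E\<^sub>1 z p r = - p $ Dv $ It + a * r $ Du $ Ix $ Ix + \<epsilon>\<^sub>0 * r $ Du $ Iy $ Iy
     - (b - w * m) * (((u_of z)\<^sup>2 + (v_of z)\<^sup>2) * u_of z)
     + w * (u_of z * (m * p $ Dphi $ It + (m * c - d) * p $ Dphi $ Iy))"

definition E\<^sub>2 :: "brzr_point \<Rightarrow> real^indep^dep \<Rightarrow> real^indep^indep^dep \<Rightarrow> real" where
  "E\<^sub>2 z p r = p $ Du $ It + a * r $ Dv $ Ix $ Ix + \<epsilon>\<^sub>0 * r $ Dv $ Iy $ Iy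
     - (b - w * m) * (((u_of z)\<^sup>2 + (v_of z)\<^sup>2) * v_of z)
     + w * (v_of z * (m * p $ Dphi $ It + (m * c - d) * p $ Dphi $ Iy))"

definition E\<^sub>3 :: "brzr_point \<Rightarrow> real^indep^dep \<Rightarrow> real^indep^indep^dep \<Rightarrow> real" where
  "E\<^sub>3 z p r = r $ Dphi $ Ix $ Ix + (1 - m * c\<^sup>2) * r $ Dphi $ Iy $ Iy
     - m * r $ Dphi $ It $ It - 2 * m * c * r $ Dphi $ Iy $ It
     - 2 * m * (u_of z * p $ Du $ It + v_of z * p $ Dv $ It)
     - 2 * (m * c - d) * (u_of z * p $ Du $ Iy + v_of z * p $ Dv $ Iy)"

lemma Re_brzr_eq1: "Re (brzr_eq1 a b c \<epsilon>\<^sub>0 d m w q) = E\<^sub>1 (fst (fst q)) (snd (fst q)) (snd q)"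
  unfolding brzr_eq1_def E\<^sub>1_def cmod_power2 by (cases q; cases "fst q") (simp add: algebra_simps)

lemma Im_brzr_eq1: "Im (brzr_eq1 a b c \<epsilon>\<^sub>0 d m w q) = E\<^sub>2 (fst (fst q)) (snd (fst q)) (snd q)"
  unfolding brzr_eq1_def E\<^sub>2_def cmod_power2 by (cases q; cases "fst q") (simp add: algebra_simps)

lemma brzr_eq2: "brzr_eq2 c d m q = E\<^sub>3 (fst (fst q)) (snd (fst q)) (snd q)"
  unfolding brzr_eq2_def E\<^sub>3_def
  by (cases q; cases "fst q") (simp add: total_deriv0_def frechet_derivative_sq_psi algebra_simps)

text \<open>The differential of \<open>E\<^sub>1\<close> at \<open>(z, p, r)\<close> in the
  direction \<open>(dz, dp, dr)\<close>. It does not depend on \<open>r\<close>, because second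
  derivatives enter linearly with constant coefficients; likewise for \<open>L\<^sub>2\<close> and
  \<open>L\<^sub>3\<close>.\<close>

definition L\<^sub>1 :: "brzr_point \<Rightarrow> real^indep^dep \<Rightarrow> brzr_point \<Rightarrow> real^indep^dep \<Rightarrow> real^indep^indep^dep \<Rightarrow> real" where
  "L\<^sub>1 z p dz dp dr = - dp $ Dv $ It + a * dr $ Du $ Ix $ Ix + \<epsilon>\<^sub>0 * dr $ Du $ Iy $ Iy
     - (b - w * m) * ((2 * u_of z * u_of dz + 2 * v_of z * v_of dz) * u_of z
          + ((u_of z)\<^sup>2 + (v_of z)\<^sup>2) * u_of dz)
     + w * (u_of dz * (m * p $ Dphi $ It + (m * c - d) * p $ Dphi $ Iy)
          + u_of z * (m * dp $ Dphi $ It + (m * c - d) * dp $ Dphi $ Iy))"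

definition L\<^sub>2 :: "brzr_point \<Rightarrow> real^indep^dep \<Rightarrow> brzr_point \<Rightarrow> real^indep^dep \<Rightarrow> real^indep^indep^dep \<Rightarrow> real" where
  "L\<^sub>2 z p dz dp dr = dp $ Du $ It + a * dr $ Dv $ Ix $ Ix + \<epsilon>\<^sub>0 * dr $ Dv $ Iy $ Iy
     - (b - w * m) * ((2 * u_of z * u_of dz + 2 * v_of z * v_of dz) * v_of z
          + ((u_of z)\<^sup>2 + (v_of z)\<^sup>2) * v_of dz)
     + w * (v_of dz * (m * p $ Dphi $ It + (m * c - d) * p $ Dphi $ Iy)
          + v_of z * (m * dp $ Dphi $ It + (m * c - d) * dp $ Dphi $ Iy))"

definition L\<^sub>3 :: "brzr_point \<Rightarrow> real^indep^dep \<Rightarrow> brzr_point \<Rightarrow> real^indep^dep \<Rightarrow> real^indep^indep^dep \<Rightarrow> real" where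
  "L\<^sub>3 z p dz dp dr = dr $ Dphi $ Ix $ Ix + (1 - m * c\<^sup>2) * dr $ Dphi $ Iy $ Iy
     - m * dr $ Dphi $ It $ It - 2 * m * c * dr $ Dphi $ Iy $ It
     - 2 * m * (u_of dz * p $ Du $ It + v_of dz * p $ Dv $ It + u_of z * dp $ Du $ It + v_of z * dp $ Dv $ It)
     - 2 * (m * c - d) * (u_of dz * p $ Du $ Iy + v_of dz * p $ Dv $ Iy
          + u_of z * dp $ Du $ Iy + v_of z * dp $ Dv $ Iy)"

lemma jet_coordinate_derivatives:
  "((\<lambda>q::(indep, dep) jet2. fst (fst (fst q)) $ k) has_derivative (\<lambda>h. fst (fst (fst h)) $ k)) (at q)"
  "((\<lambda>q::(indep, dep) jet2. snd (fst (fst q)) $ \<alpha>) has_derivative (\<lambda>h. snd (fst (fst h)) $ \<alpha>)) (at q)"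
  "((\<lambda>q::(indep, dep) jet2. snd (fst q) $ \<alpha> $ i) has_derivative (\<lambda>h. snd (fst h) $ \<alpha> $ i)) (at q)"
  "((\<lambda>q::(indep, dep) jet2. snd q $ \<alpha> $ i $ j) has_derivative (\<lambda>h. snd h $ \<alpha> $ i $ j)) (at q)"
  by (intro has_derivative_vec_nth has_derivative_fst has_derivative_snd has_derivative_ident)+

text \<open>A common template for \<open>E\<^sub>1\<close> and \<open>E\<^sub>2\<close>:
  \<open>s\<close> is -v_t or u_t, and \<open>t\<close> is the factor u or v of the cubic and the
  coupling term.\<close>

lemma has_derivative_E12:
  fixes u v s x y p q :: "'a::real_normed_vector \<Rightarrow> real"
  assumes "(u has_derivative u') (at z)" "(v has_derivative v') (at z)" "(s has_derivative s') (at z)"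
    "(t has_derivative t') (at z)"
    "(x has_derivative x') (at z)" "(y has_derivative y') (at z)" "(p has_derivative p') (at z)"
    "(q has_derivative q') (at z)"
  shows "((\<lambda>z. s z + A * x z + B * y z - C * (((u z)\<^sup>2 + (v z)\<^sup>2) * t z) + D * (t z * (P * p z + Q * q z)))
    has_derivative (\<lambda>h. s' h + A * x' h + B * y' h - C * ((2 * u z * u' h + 2 * v z * v' h) * t z + ((u z)\<^sup>2 + (v z)\<^sup>2) * t' h)
      + D * (t' h * (P * p z + Q * q z) + t z * (P * p' h + Q * q' h)))) (at z)"
  by (rule derivative_eq_intros assms refl | simp add: algebra_simps)+

lemma has_derivative_E3:
  fixes u v :: "'a::real_normed_vector \<Rightarrow> real"
  assumes "(u has_derivative u') (at z)" "(v has_derivative v') (at z)" "(f has_derivative f') (at z)"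
    "(g has_derivative g') (at z)"
    "(x has_derivative x') (at z)" "(y has_derivative y') (at z)" "(p has_derivative p') (at z)"
    "(q has_derivative q') (at z)" "(r has_derivative r') (at z)" "(s has_derivative s') (at z)"
  shows "((\<lambda>z. x z + A * y z - B * p z - C * q z - D * (u z * f z + v z * g z) - E * (u z * r z + v z * s z))
    has_derivative (\<lambda>h. x' h + A * y' h - B * p' h - C * q' h
      - D * (u' h * f z + v' h * g z + u z * f' h + v z * g' h)
      - E * (u' h * r z + v' h * s z + u z * r' h + v z * s' h))) (at z)"
  by (rule derivative_eq_intros assms refl | simp add: algebra_simps)+

lemma frechet_E:
  "frechet_derivative (\<lambda>q. E\<^sub>1 (fst (fst q)) (snd (fst q)) (snd q)) (at ((z, p), r)) ((dz, dp), dr) = L\<^sub>1 z p dz dp dr"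
  "frechet_derivative (\<lambda>q. E\<^sub>2 (fst (fst q)) (snd (fst q)) (snd q)) (at ((z, p), r)) ((dz, dp), dr) = L\<^sub>2 z p dz dp dr"
  "frechet_derivative (\<lambda>q. E\<^sub>3 (fst (fst q)) (snd (fst q)) (snd q)) (at ((z, p), r)) ((dz, dp), dr) = L\<^sub>3 z p dz dp dr"
  unfolding E\<^sub>1_def E\<^sub>2_def E\<^sub>3_def L\<^sub>1_def L\<^sub>2_def L\<^sub>3_def
  by (subst frechet_derivative_eqI[OF has_derivative_E12[OF jet_coordinate_derivatives(2,2)
        has_derivative_minus[OF jet_coordinate_derivatives(3)] jet_coordinate_derivatives(2,4,4,3,3)]]
      frechet_derivative_eqI[OF has_derivative_E12[OF jet_coordinate_derivatives(2,2,3,2,4,4,3,3)]]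
      frechet_derivative_eqI[OF has_derivative_E3[OF jet_coordinate_derivatives(2,2,3,3,4,4,4,4,3,3)]];
      simp)+

definition pr1 :: "brzr_field \<Rightarrow> brzr_point \<Rightarrow> real^indep^dep \<Rightarrow> real^indep^dep" where
  "pr1 X z p = (\<chi> \<alpha> i. prolong_coeff1 X \<alpha> i (z, p))"

definition pr2 :: "brzr_field \<Rightarrow> brzr_point \<Rightarrow> real^indep^dep \<Rightarrow> real^indep^indep^dep \<Rightarrow> real^indep^indep^dep" where
  "pr2 X z p r = (\<chi> \<alpha> i j. prolong_coeff2 X \<alpha> i j ((z, p), r))"

definition is_sol :: "brzr_point \<Rightarrow> real^indep^dep \<Rightarrow> real^indep^indep^dep \<Rightarrow> bool" where
  "is_sol z p r \<longleftrightarrow> symmetric_jet r \<and> E\<^sub>1 z p r = 0 \<and> E\<^sub>2 z p r = 0 \<and> E\<^sub>3 z p r = 0"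

abbreviation LSA :: "brzr_field set" where
  "LSA \<equiv> lie_symmetry_algebra (brzr_system a b c \<epsilon>\<^sub>0 d m w)"

lemma lie_symmetry_iff:
  "X \<in> LSA \<longleftrightarrow>
    smooth X \<and> (\<forall>z p r. is_sol z p r \<longrightarrow>
      L\<^sub>1 z p (X z) (pr1 X z p) (pr2 X z p r) = 0 \<and>
      L\<^sub>2 z p (X z) (pr1 X z p) (pr2 X z p r) = 0 \<and>
      L\<^sub>3 z p (X z) (pr1 X z p) (pr2 X z p r) = 0)"
proof -
  have eq2: "brzr_eq2 c d m = (\<lambda>q. E\<^sub>3 (fst (fst q)) (snd (fst q)) (snd q))"
    by (simp add: fun_eq_iff brzr_eq2)
  show ?thesis
    unfolding lie_symmetry_algebra_def brzr_system_def Re_brzr_eq1 Im_brzr_eq1 eq2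
    by (force simp: jets2_def is_sol_def symmetric_jet_def prolong2_def frechet_E pr1_def pr2_def)
qed

end

section \<open>Conditions from varying the second derivatives over fixed first derivatives\<close>

lemma d_const [simp]: "d_indep i (\<lambda>z. k) = (\<lambda>z. 0)" "d_dep \<alpha> (\<lambda>z. k) = (\<lambda>z. 0)"
  by (simp_all add: d_indep_def d_dep_def)

lemma d_dep_d_indep:
  assumes "smooth f"
  shows "d_dep \<alpha> (d_indep i f) = d_indep i (d_dep \<alpha> f)"
  unfolding d_dep_def d_indep_def by (rule dirderiv_commute[OF assms])

lemma total_deriv0_zero:
  fixes f :: "('i::finite, 'd::finite) jet0 \<Rightarrow> real"
  shows "smooth f \<Longrightarrow> total_deriv0 i f (z, 0) = d_indep i f z"
  by (simp add: total_deriv0_eq)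

text \<open>
  The change of the prolongation between two jets with the same first derivatives whose second
  derivatives differ by \<open>s\<close>.
\<close>

definition top_part ::
    "('i::finite, 'd::finite) vfield \<Rightarrow> 'd \<Rightarrow> 'i \<Rightarrow> 'i \<Rightarrow> ('i, 'd) jet2 \<Rightarrow> real" where
  "top_part X \<alpha> i j = (\<lambda>((z, p), s).
     (\<Sum>\<beta>\<in>UNIV. s $ \<beta> $ i $ j * (d_dep \<beta> (\<lambda>z. snd (X z) $ \<alpha>) z
        - (\<Sum>k\<in>UNIV. p $ \<alpha> $ k * d_dep \<beta> (\<lambda>z. fst (X z) $ k) z)))
     - (\<Sum>k\<in>UNIV. s $ \<alpha> $ k $ j * total_deriv0 i (\<lambda>z. fst (X z) $ k) (z, p)
        + s $ \<alpha> $ i $ k * total_deriv0 j (\<lambda>z. fst (X z) $ k) (z, p)))"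

text \<open>Over fixed \<open>z\<close> and \<open>p\<close> the coefficient is affine in the second
  derivatives, so an increment enters only through its linear part.\<close>

lemma prolong_coeff2_add:
  fixes X :: "('i::finite, 'd::finite) vfield"
  assumes "smooth X"
  shows "prolong_coeff2 X \<alpha> i j ((z, p), r + s) = prolong_coeff2 X \<alpha> i j ((z, p), r) + top_part X \<alpha> i j ((z, p), s)"
proof -
  have "(\<Sum>\<beta>\<in>UNIV. s $ \<beta> $ i $ j * (\<Sum>k\<in>UNIV. p $ \<alpha> $ k * d_dep \<beta> (\<lambda>z. fst (X z) $ k) z))
      = (\<Sum>k\<in>UNIV. p $ \<alpha> $ k * (\<Sum>\<beta>\<in>UNIV. s $ \<beta> $ i $ j * d_dep \<beta> (\<lambda>z. fst (X z) $ k) z))"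
    by (simp add: sum_distrib_left mult_ac) (rule sum.swap)
  then show ?thesis
    unfolding prolong_coeff2_eq[OF assms] total_deriv2_def top_part_def
    by (simp add: sum.distrib sum_subtractf algebra_simps)
qed

text \<open>A total derivative is affine in \<open>p\<close>. The choice p = 0 isolates the explicit
  partial derivatives; for i \<noteq> j the two total derivatives involve different columns of
  \<open>p\<close>, so a single nonzero entry isolates one derivative in a dependent
  variable.\<close>

lemma total_relationD:
  fixes f g :: "brzr_point \<Rightarrow> real"
  assumes "smooth f" "smooth g" "\<And>p. A * total_deriv0 i f (z, p) + B * total_deriv0 j g (z, p) = 0"
  shows "A * d_indep i f z + B * d_indep j g z = 0"
    and "i \<noteq> j \<Longrightarrow> A * d_dep \<alpha> f z = 0"
    and "i \<noteq> j \<Longrightarrow> B * d_dep \<alpha> g z = 0"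
proof -
  show *: "A * d_indep i f z + B * d_indep j g z = 0"
    using assms(3)[of 0] by (simp add: total_deriv0_zero assms)
  assume "i \<noteq> j"
  have "A * d_indep i f z + B * d_indep j g z + A * d_dep \<alpha> f z = 0"
    using assms(3)[of "axis \<alpha> (axis i 1)"] \<open>i \<noteq> j\<close>
    by (cases \<alpha>) (simp_all add: total_deriv0_eq assms(1,2) sum_dep axis_def algebra_simps)
  then show "A * d_dep \<alpha> f z = 0"
    using * by linarith
  have "A * d_indep i f z + B * d_indep j g z + B * d_dep \<alpha> g z = 0"
    using assms(3)[of "axis \<alpha> (axis j 1)"] \<open>i \<noteq> j\<close>
    by (cases \<alpha>) (simp_all add: total_deriv0_eq assms(1,2) sum_dep axis_def algebra_simps)
  then show "B * d_dep \<alpha> g z = 0"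
    using * by linarith
qed

text \<open>The test directions for second derivatives: symmetrised unit arrays, so that adding one
  to an actual jet gives an actual jet.\<close>

definition mono2 :: "dep \<Rightarrow> indep \<Rightarrow> indep \<Rightarrow> real^indep^indep^dep" where
  "mono2 \<alpha> i j = (\<chi> \<beta> k l. if \<beta> = \<alpha> \<and> (k = i \<and> l = j \<or> k = j \<and> l = i) then 1 else 0)"

lemma mono2_nth [simp]:
  "mono2 \<alpha> i j $ \<beta> $ k $ l = (if \<beta> = \<alpha> \<and> (k = i \<and> l = j \<or> k = j \<and> l = i) then 1 else 0)"
  by (simp add: mono2_def)

lemma symmetric_jet [simp]:
  "symmetric_jet (mono2 \<alpha> i j)"
  "symmetric_jet r \<Longrightarrow> symmetric_jet s \<Longrightarrow> symmetric_jet (r + s)"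
  "symmetric_jet r \<Longrightarrow> symmetric_jet s \<Longrightarrow> symmetric_jet (r - s)"
  "symmetric_jet r \<Longrightarrow> symmetric_jet (x *\<^sub>R r)"
  by (auto simp: symmetric_jet_def)

context brzr
begin

text \<open>Each equation is solved for its xx-derivative, whose coefficient is a or 1, and all
  other second derivatives are zero. Thus every \<open>z\<close> and \<open>p\<close> extend to a
  jet in the solution set.\<close>

definition base_jet :: "brzr_point \<Rightarrow> real^indep^dep \<Rightarrow> real^indep^indep^dep" where
  "base_jet z p = (\<chi> \<alpha> i j. if i = Ix \<and> j = Ix then (case \<alpha> of
      Du \<Rightarrow> (p $ Dv $ It + (b - w * m) * (((u_of z)\<^sup>2 + (v_of z)\<^sup>2) * u_of z)
        - w * (u_of z * (m * p $ Dphi $ It + (m * c - d) * p $ Dphi $ Iy))) / a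
    | Dv \<Rightarrow> (- p $ Du $ It + (b - w * m) * (((u_of z)\<^sup>2 + (v_of z)\<^sup>2) * v_of z)
        - w * (v_of z * (m * p $ Dphi $ It + (m * c - d) * p $ Dphi $ Iy))) / a
    | Dphi \<Rightarrow> 2 * m * (u_of z * p $ Du $ It + v_of z * p $ Dv $ It)
        + 2 * (m * c - d) * (u_of z * p $ Du $ Iy + v_of z * p $ Dv $ Iy)) else 0)"

lemma is_sol_base_jet: "is_sol z p (base_jet z p)"
proof -
  let ?r = "base_jet z p"
  have "symmetric_jet ?r"
    by (auto simp: base_jet_def symmetric_jet_def)
  moreover have "E\<^sub>1 z p ?r = 0" "E\<^sub>2 z p ?r = 0" "E\<^sub>3 z p ?r = 0"
    using a by (simp_all add: E\<^sub>1_def E\<^sub>2_def E\<^sub>3_def base_jet_def)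
  ultimately show ?thesis
    unfolding is_sol_def by blast
qed

lemma lie_symmetryD:
  assumes "X \<in> LSA" "is_sol z p r"
  shows "L\<^sub>1 z p (X z) (pr1 X z p) (pr2 X z p r) = 0"
    and "L\<^sub>2 z p (X z) (pr1 X z p) (pr2 X z p r) = 0"
    and "L\<^sub>3 z p (X z) (pr1 X z p) (pr2 X z p r) = 0"
  using assms unfolding lie_symmetry_iff by blast+

text \<open>The symmetry condition at \<open>base_jet z p\<close> is subtracted from that at
  \<open>base_jet z p + s\<close>; the hypotheses on \<open>s\<close> keep the second jet in the
  solution set. Everything not involving \<open>s\<close> cancels.\<close>

lemma top_conditions:
  assumes X: "X \<in> LSA"
    and sym: "symmetric_jet s"
    and u: "a * s $ Du $ Ix $ Ix + \<epsilon>\<^sub>0 * s $ Du $ Iy $ Iy = 0"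
    and v: "a * s $ Dv $ Ix $ Ix + \<epsilon>\<^sub>0 * s $ Dv $ Iy $ Iy = 0"
    and phi: "s $ Dphi $ Ix $ Ix + (1 - m * c\<^sup>2) * s $ Dphi $ Iy $ Iy
       - m * s $ Dphi $ It $ It - 2 * m * c * s $ Dphi $ Iy $ It = 0"
  shows "a * top_part X Du Ix Ix ((z, p), s) + \<epsilon>\<^sub>0 * top_part X Du Iy Iy ((z, p), s) = 0"
    and "a * top_part X Dv Ix Ix ((z, p), s) + \<epsilon>\<^sub>0 * top_part X Dv Iy Iy ((z, p), s) = 0"
    and "top_part X Dphi Ix Ix ((z, p), s) + (1 - m * c\<^sup>2) * top_part X Dphi Iy Iy ((z, p), s)
       - m * top_part X Dphi It It ((z, p), s) - 2 * m * c * top_part X Dphi Iy It ((z, p), s) = 0"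
proof -
  have sm: "smooth X"
    using X by (simp add: lie_symmetry_iff)
  define r where "r = base_jet z p"
  have r: "is_sol z p r"
    unfolding r_def by (rule is_sol_base_jet)
  have rs: "is_sol z p (r + s)"
    unfolding is_sol_def
  proof (intro conjI)
    show "symmetric_jet (r + s)"
      using r sym by (simp add: is_sol_def)
    have "E\<^sub>1 z p r = 0" "E\<^sub>2 z p r = 0" "E\<^sub>3 z p r = 0"
      using r by (simp_all add: is_sol_def)
    then show "E\<^sub>1 z p (r + s) = 0" "E\<^sub>2 z p (r + s) = 0" "E\<^sub>3 z p (r + s) = 0"
      using u v phi by (simp_all add: E\<^sub>1_def E\<^sub>2_def E\<^sub>3_def algebra_simps)
  qed
  have *: "L\<^sub>1 z p (X z) (pr1 X z p) (pr2 X z p (r + s)) = L\<^sub>1 z p (X z) (pr1 X z p) (pr2 X z p r)"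
    "L\<^sub>2 z p (X z) (pr1 X z p) (pr2 X z p (r + s)) = L\<^sub>2 z p (X z) (pr1 X z p) (pr2 X z p r)"
    "L\<^sub>3 z p (X z) (pr1 X z p) (pr2 X z p (r + s)) = L\<^sub>3 z p (X z) (pr1 X z p) (pr2 X z p r)"
    using lie_symmetryD[OF X r] lie_symmetryD[OF X rs] by simp_all
  show "a * top_part X Du Ix Ix ((z, p), s) + \<epsilon>\<^sub>0 * top_part X Du Iy Iy ((z, p), s) = 0"
    using *(1) unfolding L\<^sub>1_def pr2_def by (simp add: prolong_coeff2_add[OF sm] algebra_simps)
  show "a * top_part X Dv Ix Ix ((z, p), s) + \<epsilon>\<^sub>0 * top_part X Dv Iy Iy ((z, p), s) = 0"
    using *(2) unfolding L\<^sub>2_def pr2_def by (simp add: prolong_coeff2_add[OF sm] algebra_simps)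
  show "top_part X Dphi Ix Ix ((z, p), s) + (1 - m * c\<^sup>2) * top_part X Dphi Iy Iy ((z, p), s)
       - m * top_part X Dphi It It ((z, p), s) - 2 * m * c * top_part X Dphi Iy It ((z, p), s) = 0"
    using *(3) unfolding L\<^sub>3_def pr2_def by (simp add: prolong_coeff2_add[OF sm] algebra_simps)
qed

text \<open>The derivatives u_xt, u_yt and u_xy occur in no equation and can be changed without
  compensation. In the prolonged equation they enter through the coefficients of u_xx and u_yy,
  multiplied by total derivatives of the \<xi>'s.\<close>

lemma mono2_conditions_u:
  assumes X: "X \<in> LSA"
  shows "total_deriv0 Ix (xi X It) (z, p) = 0" "total_deriv0 Iy (xi X It) (z, p) = 0"
    "a * total_deriv0 Ix (xi X Iy) (z, p) + \<epsilon>\<^sub>0 * total_deriv0 Iy (xi X Ix) (z, p) = 0"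
proof -
  show "total_deriv0 Ix (xi X It) (z, p) = 0"
    using top_conditions(1)[OF X, of "mono2 Du Ix It" z p] a
    by (simp add: top_part_def sum_indep sum_dep)
  show "total_deriv0 Iy (xi X It) (z, p) = 0"
    using top_conditions(1)[OF X, of "mono2 Du Iy It" z p] eps
    by (simp add: top_part_def sum_indep sum_dep)
  have "top_part X Du Ix Ix ((z, p), mono2 Du Ix Iy) = - 2 * total_deriv0 Ix (xi X Iy) (z, p)"
    "top_part X Du Iy Iy ((z, p), mono2 Du Ix Iy) = - 2 * total_deriv0 Iy (xi X Ix) (z, p)"
    by (simp_all add: top_part_def sum_indep sum_dep)
  moreover have "a * top_part X Du Ix Ix ((z, p), mono2 Du Ix Iy)
      + \<epsilon>\<^sub>0 * top_part X Du Iy Iy ((z, p), mono2 Du Ix Iy) = 0"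
    by (rule top_conditions(1)[OF X]) simp_all
  ultimately have "a * (- 2 * total_deriv0 Ix (xi X Iy) (z, p)) + \<epsilon>\<^sub>0 * (- 2 * total_deriv0 Iy (xi X Ix) (z, p)) = 0"
    by (simp only:)
  then show "a * total_deriv0 Ix (xi X Iy) (z, p) + \<epsilon>\<^sub>0 * total_deriv0 Iy (xi X Ix) (z, p) = 0"
    by linarith
qed

context
  fixes X assumes X: "X \<in> LSA"
begin

lemma smooth_X: "smooth X"
  using X by (simp add: lie_symmetry_iff)

lemmas smooth_xi_eta = smooth_components[OF smooth_X]

text \<open>The relations of \<open>mono2_conditions_u\<close> hold for all first derivatives, so
  \<open>total_relationD\<close> kills the dependence on u, v and phi.\<close>

lemma d_dep_xi: "d_dep \<alpha> (xi X k) z = 0"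
proof -
  have "d_dep \<alpha> (xi X It) z = 0"
    using total_relationD(2)[OF smooth_xi_eta(1) smooth_xi_eta(1), of 1 Ix It z 0 Iy It]
      mono2_conditions_u(1)[OF X] by simp
  moreover have "d_dep \<alpha> (xi X Iy) z = 0" "d_dep \<alpha> (xi X Ix) z = 0"
    using total_relationD(2,3)[OF smooth_xi_eta(1) smooth_xi_eta(1), of a Ix Iy z \<epsilon>\<^sub>0 Iy Ix]
      mono2_conditions_u(3)[OF X] a eps by simp_all
  ultimately show ?thesis
    by (cases k) simp_all
qed

lemma total_xi [simp]: "total_deriv0 i (xi X k) (z, p) = d_indep i (xi X k) z"
  by (simp add: total_deriv0_eq smooth_xi_eta d_dep_xi)

lemma xi_relations:
  "d_indep Ix (xi X It) z = 0" "d_indep Iy (xi X It) z = 0"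
  "a * d_indep Ix (xi X Iy) z + \<epsilon>\<^sub>0 * d_indep Iy (xi X Ix) z = 0"
  using mono2_conditions_u[OF X, of z 0] by simp_all

lemma top_part_X:
  "top_part X \<alpha> i j ((z, p), s) = (\<Sum>\<beta>\<in>UNIV. s $ \<beta> $ i $ j * d_dep \<beta> (eta X \<alpha>) z)
     - (\<Sum>k\<in>UNIV. s $ \<alpha> $ k $ j * d_indep i (xi X k) z + s $ \<alpha> $ i $ k * d_indep j (xi X k) z)"
  by (simp add: top_part_def d_dep_xi)

text \<open>Increments of phi_xx and phi_tt in the ratio m : 1 preserve the wave equation and are
  invisible to the Schroedinger equation, but they change the prolonged u_xx and v_xx through the
  phi-derivatives of \<eta>.\<close>

lemma eta_psi_phi: "d_dep Dphi (eta X Du) z = 0" "d_dep Dphi (eta X Dv) z = 0"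
  using top_conditions(1,2)[OF X, of "m *\<^sub>R mono2 Dphi Ix Ix + mono2 Dphi It It" z 0] a m
  by (simp_all add: top_part_X sum_indep sum_dep)

text \<open>Here u_tt and v_tt are varied, which occur in no equation, while the prolonged wave
  equation contains the coefficient of phi_tt.\<close>

lemma eta_phi_psi: "d_dep Du (eta X Dphi) z = 0" "d_dep Dv (eta X Dphi) z = 0"
  using top_conditions(3)[OF X, of "mono2 Du It It" z 0]
    top_conditions(3)[OF X, of "mono2 Dv It It" z 0] m
  by (simp_all add: top_part_X sum_indep sum_dep)

text \<open>Trading u_xx against u_yy in the Schroedinger equation compares the scalings of x and y;
  trading phi_xx against phi_tt in the wave equation compares those of x and t.\<close>

lemma xi_diag:
  "d_indep Iy (xi X Iy) z = d_indep Ix (xi X Ix) z" "d_indep It (xi X It) z = d_indep Ix (xi X Ix) z"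
  using top_conditions(1)[OF X, of "a *\<^sub>R mono2 Du Iy Iy - \<epsilon>\<^sub>0 *\<^sub>R mono2 Du Ix Ix" z 0] a eps
    top_conditions(3)[OF X, of "m *\<^sub>R mono2 Dphi Ix Ix + mono2 Dphi It It" z 0] m
  by (simp_all add: top_part_X sum_indep sum_dep xi_relations algebra_simps)

text \<open>The derivative phi_xt is absent from the wave equation, and phi_yt can be balanced by 2
  m c phi_xx.\<close>

lemma xi_t:
  "d_indep It (xi X Ix) z + c * d_indep Iy (xi X Ix) z = 0" "d_indep It (xi X Iy) z = 0"
proof -
  have "2 * m * (d_indep It (xi X Ix) z + c * d_indep Iy (xi X Ix) z) = 0"
    using top_conditions(3)[OF X, of "mono2 Dphi Ix It" z 0]
    by (simp add: top_part_X sum_indep sum_dep xi_relations algebra_simps)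
  then show "d_indep It (xi X Ix) z + c * d_indep Iy (xi X Ix) z = 0"
    using m by simp
  have "2 * m * d_indep It (xi X Iy) z = 0"
    using top_conditions(3)[OF X, of "(2 * m * c) *\<^sub>R mono2 Dphi Ix Ix + mono2 Dphi Iy It" z 0]
    by (simp add: top_part_X sum_indep sum_dep xi_relations xi_diag algebra_simps)
  then show "d_indep It (xi X Iy) z = 0"
    using m by simp
qed

lemma d_dep_xi_fun [simp]: "d_dep \<alpha> (xi X k) = (\<lambda>z. 0)"
  by (rule ext) (rule d_dep_xi)

lemma d_dep_eta_fun [simp]: "d_dep Dphi (eta X Du) = (\<lambda>z. 0)" "d_dep Dphi (eta X Dv) = (\<lambda>z. 0)"
  "d_dep Du (eta X Dphi) = (\<lambda>z. 0)" "d_dep Dv (eta X Dphi) = (\<lambda>z. 0)"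
  by (rule ext, rule eta_psi_phi eta_phi_psi)+

section \<open>Conditions from varying the first derivatives\<close>

lemmas eval_simps = pr1_def pr2_def prolong_coeff1_conv prolong_coeff2_eq[OF smooth_X] total_deriv2_def
  total_deriv0_eq sum_dep sum_indep smooth_d_indep smooth_d_dep smooth_xi_eta
  d_dep_d_indep[OF smooth_xi_eta(1)] d_dep_d_indep[OF smooth_xi_eta(2)]

text \<open>The derivative phi_x occurs in no equation, but the prolongations of phi_t and phi_y
  contain it with the factors -\<xi>^x_t and -\<xi>^x_y.\<close>

lemma xi_x_transport: "u_of z * (m * d_indep It (xi X Ix) z + (m * c - d) * d_indep Iy (xi X Ix) z) = 0"
proof -
  obtain r where r: "is_sol z 0 r"
    using is_sol_base_jet by blast
  have r': "is_sol z (axis Dphi (axis Ix 1)) r"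
    using r by (simp add: is_sol_def E\<^sub>1_def E\<^sub>2_def E\<^sub>3_def axis_def)
  have "w * (u_of z * (m * d_indep It (xi X Ix) z + (m * c - d) * d_indep Iy (xi X Ix) z)) = 0"
    using lie_symmetryD(1)[OF X r] lie_symmetryD(1)[OF X r']
    by (simp add: L\<^sub>1_def eval_simps axis_def algebra_simps del: mult_eq_0_iff)
  then show ?thesis
    using w by simp
qed

text \<open>The terms v_t and a u_xx must scale alike, where one t-derivative counts as \<xi>^x_x by
  \<open>xi_diag\<close> and two x-derivatives count double. The pair u_t and v_xx in
  \<open>xi_eta_u\<close> gives the same right-hand side with the opposite left-hand side, so the
  sum of both relations excludes scalings.\<close>

lemma xi_eta_v: "d_dep Dv (eta X Dv) z - d_dep Du (eta X Du) z = - d_indep Ix (xi X Ix) z"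
proof -
  obtain r where r: "is_sol z 0 r"
    using is_sol_base_jet by blast
  \<comment> \<open>The value v_t = 1 is balanced by 1/a in u_xx and, in the wave equation, by 2 m v
    in phi_xx.\<close>
  have r': "is_sol z (axis Dv (axis It 1)) (r + (1 / a) *\<^sub>R mono2 Du Ix Ix + (2 * m * v_of z) *\<^sub>R mono2 Dphi Ix Ix)"
    using r a by (simp add: is_sol_def E\<^sub>1_def E\<^sub>2_def E\<^sub>3_def axis_def algebra_simps)
  show ?thesis
    using lie_symmetryD(1)[OF X r] lie_symmetryD(1)[OF X r'] a
    by (simp add: L\<^sub>1_def eval_simps axis_def algebra_simps xi_diag)
qed

lemma xi_eta_u: "d_dep Du (eta X Du) z - d_dep Dv (eta X Dv) z = - d_indep Ix (xi X Ix) z"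
proof -
  obtain r where r: "is_sol z 0 r"
    using is_sol_base_jet by blast
  have r': "is_sol z (axis Du (axis It 1)) (r - (1 / a) *\<^sub>R mono2 Dv Ix Ix + (2 * m * u_of z) *\<^sub>R mono2 Dphi Ix Ix)"
    using r a by (simp add: is_sol_def E\<^sub>1_def E\<^sub>2_def E\<^sub>3_def axis_def algebra_simps)
  show ?thesis
    using lie_symmetryD(2)[OF X r] lie_symmetryD(2)[OF X r'] a
    by (simp add: L\<^sub>2_def eval_simps axis_def algebra_simps xi_diag)
qed

end

end

section \<open>Normal form of a symmetry: translation, phase rotation and shift of phi\<close>

lemma smooth_coord: "smooth (\<lambda>z::('i::finite, 'd::finite) jet0. fst z $ i)"
  "smooth (\<lambda>z::('i, 'd) jet0. snd z $ \<alpha>)"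
  by (intro smooth_bounded_linear bounded_linear_compose[OF bounded_linear_vec_nth]
      bounded_linear_fst bounded_linear_snd)+

lemma d_dep_commute: "smooth f \<Longrightarrow> d_dep \<alpha> (d_dep \<beta> f) = d_dep \<beta> (d_dep \<alpha> f)"
  unfolding d_dep_def by (rule dirderiv_commute)

lemma d_indep_commute: "smooth f \<Longrightarrow> d_indep i (d_indep j f) = d_indep j (d_indep i f)"
  unfolding d_indep_def by (rule dirderiv_commute)

text \<open>Moving along the axis of the dependent variable does not change \<open>f\<close>, so it
  can be evaluated where that variable equals 1.\<close>

lemma zero_off_hyperplane:
  fixes f :: "('i::finite, 'd::finite) jet0 \<Rightarrow> real"
  assumes "smooth f" "d_dep \<alpha> f = (\<lambda>z. 0)" "\<And>z. snd z $ \<alpha> * f z = 0"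
  shows "f z = 0"
proof -
  let ?z = "z + (1 - snd z $ \<alpha>) *\<^sub>R (0, axis \<alpha> 1)"
  have "f ?z = f z"
    using assms(2) by (intro constant_along assms(1)) (simp add: d_dep_def)
  moreover have "snd ?z $ \<alpha> = 1"
    by simp
  ultimately show ?thesis
    using assms(3)[of ?z] by simp
qed

lemma constant_if_partials_zero:
  fixes f :: "('i::finite, 'd::finite) jet0 \<Rightarrow> real"
  assumes "smooth f" "\<And>i. d_indep i f = (\<lambda>z. 0)" "\<And>\<alpha>. d_dep \<alpha> f = (\<lambda>z. 0)"
  shows "f z = f 0"
  using constant_along[OF assms(1), of z 0 1] by (simp add: dirderiv_expand assms)

lemma d_coord_mult:
  fixes f :: "('i::finite, 'd::finite) jet0 \<Rightarrow> real"
  assumes "smooth f"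
  shows "d_indep i (\<lambda>z. snd z $ \<alpha> * f z) = (\<lambda>z. snd z $ \<alpha> * d_indep i f z)"
    and "d_dep \<beta> (\<lambda>z. snd z $ \<alpha> * f z) = (\<lambda>z. (if \<alpha> = \<beta> then f z else 0) + snd z $ \<alpha> * d_dep \<beta> f z)"
proof -
  have bl: "bounded_linear (\<lambda>z::('i, 'd) jet0. snd z $ \<alpha>)"
    by (intro bounded_linear_compose[OF bounded_linear_vec_nth] bounded_linear_snd)
  show "d_indep i (\<lambda>z. snd z $ \<alpha> * f z) = (\<lambda>z. snd z $ \<alpha> * d_indep i f z)"
    "d_dep \<beta> (\<lambda>z. snd z $ \<alpha> * f z) = (\<lambda>z. (if \<alpha> = \<beta> then f z else 0) + snd z $ \<alpha> * d_dep \<beta> f z)"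
    unfolding d_indep_def d_dep_def dirderiv_mult[OF smooth_coord(2) assms] dirderiv_bounded_linear[OF bl]
    by (auto simp: fun_eq_iff axis_def)
qed

lemma d_uminus:
  fixes f :: "('i::finite, 'd::finite) jet0 \<Rightarrow> real"
  assumes "smooth f"
  shows "d_indep i (\<lambda>z. - f z) = (\<lambda>z. - d_indep i f z)" "d_dep \<alpha> (\<lambda>z. - f z) = (\<lambda>z. - d_dep \<alpha> f z)"
  unfolding d_indep_def d_dep_def
  using dirderiv_bounded_linear_comp[OF assms bounded_linear_minus[OF bounded_linear_ident]] by simp_all

lemma smooth_uminus:
  fixes f :: "('i::finite, 'd::finite) jet0 \<Rightarrow> real"
  shows "smooth f \<Longrightarrow> smooth (\<lambda>z. - f z)"
  by (rule smooth_bounded_linear_comp[OF _ bounded_linear_minus[OF bounded_linear_ident]])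

text \<open>The phase rate \<open>B\<close> and the shift \<open>h\<close> are functions of all
  variables, so that the calculus of partial derivatives applies to them; \<open>admissible\<close>
  imposes the variables on which they may depend.\<close>

definition sym_field :: "real^indep \<Rightarrow> (brzr_point \<Rightarrow> real) \<Rightarrow> (brzr_point \<Rightarrow> real) \<Rightarrow> brzr_field" where
  "sym_field k B h = (\<lambda>z. (k, \<chi> \<alpha>. case \<alpha> of Du \<Rightarrow> - (v_of z * B z) | Dv \<Rightarrow> u_of z * B z | Dphi \<Rightarrow> h z))"

lemma sym_field_components [simp]:
  "fst (sym_field k B h z) = k"
  "snd (sym_field k B h z) $ Du = - (v_of z * B z)"
  "snd (sym_field k B h z) $ Dv = u_of z * B z"
  "snd (sym_field k B h z) $ Dphi = h z"
  by (simp_all add: sym_field_def)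

lemma smooth_sym_field:
  assumes "smooth B" "smooth h"
  shows "smooth (sym_field k B h)"
proof -
  have "sym_field k B h = (\<lambda>z. (k, 0) + ((- (v_of z * B z)) *\<^sub>R (0, axis Du 1)
      + ((u_of z * B z) *\<^sub>R (0, axis Dv 1) + h z *\<^sub>R (0, axis Dphi 1))))"
    by (auto simp: sym_field_def fun_eq_iff vec_eq_iff axis_def split: dep.split) (metis dep.exhaust)
  then show ?thesis
    by (simp only:) (intro smooth_add smooth_scaleR smooth_const smooth_uminus smooth_mult smooth_coord assms)
qed

context brzr
begin

definition wave_op :: "(brzr_point \<Rightarrow> real) \<Rightarrow> brzr_point \<Rightarrow> real" where
  "wave_op h z = d_indep Ix (d_indep Ix h) z + (1 - m * c\<^sup>2) * d_indep Iy (d_indep Iy h) z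
     - m * d_indep It (d_indep It h) z - 2 * m * c * d_indep It (d_indep Iy h) z"

definition transport :: "(brzr_point \<Rightarrow> real) \<Rightarrow> brzr_point \<Rightarrow> real" where
  "transport h z = m * d_indep It h z + (m * c - d) * d_indep Iy h z"

text \<open>A phase rotation turns the pair (\<open>E\<^sub>1\<close>, \<open>E\<^sub>2\<close>) by
  the same angle, hence the multiples of the equations. What is left over is the time derivative of
  the rate against the change of the potential caused by \<open>h\<close>. The third equation sees
  only \<open>h\<close>, because |psi|^2 is invariant.\<close>

lemma L_sym_field:
  fixes k
  assumes B: "smooth B" "\<And>\<alpha>. d_dep \<alpha> B = (\<lambda>z. 0)" "d_indep Ix B = (\<lambda>z. 0)" "d_indep Iy B = (\<lambda>z. 0)"
    and h: "smooth h" "\<And>\<alpha>. d_dep \<alpha> h = (\<lambda>z. 0)"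
  defines "X \<equiv> sym_field k B h"
  shows "L\<^sub>1 z p (X z) (pr1 X z p) (pr2 X z p r) = - B z * E\<^sub>2 z p r + u_of z * (w * transport h z - d_indep It B z)"
    and "L\<^sub>2 z p (X z) (pr1 X z p) (pr2 X z p r) = B z * E\<^sub>1 z p r + v_of z * (w * transport h z - d_indep It B z)"
    and "L\<^sub>3 z p (X z) (pr1 X z p) (pr2 X z p r) = wave_op h z"
proof -
  note simps = E\<^sub>1_def E\<^sub>2_def L\<^sub>1_def L\<^sub>2_def L\<^sub>3_def pr1_def pr2_def prolong_coeff1_conv
    prolong_coeff2_eq[OF smooth_sym_field[OF B(1) h(1)]] total_deriv2_def total_deriv0_eq sum_dep sum_indep
    smooth_d_indep smooth_d_dep smooth_coord smooth_mult smooth_uminus B h d_uminus d_coord_mult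
    d_dep_d_indep[OF B(1)] d_dep_d_indep[OF h(1)] wave_op_def transport_def
  show "L\<^sub>1 z p (X z) (pr1 X z p) (pr2 X z p r) = - B z * E\<^sub>2 z p r + u_of z * (w * transport h z - d_indep It B z)"
    unfolding X_def by (simp add: simps) (simp add: algebra_simps power2_eq_square)
  show "L\<^sub>2 z p (X z) (pr1 X z p) (pr2 X z p r) = B z * E\<^sub>1 z p r + v_of z * (w * transport h z - d_indep It B z)"
    unfolding X_def by (simp add: simps) (simp add: algebra_simps power2_eq_square)
  show "L\<^sub>3 z p (X z) (pr1 X z p) (pr2 X z p r) = wave_op h z"
    unfolding X_def by (simp add: simps) (simp add: algebra_simps power2_eq_square)
qed

definition admissible :: "(brzr_point \<Rightarrow> real) \<Rightarrow> (brzr_point \<Rightarrow> real) \<Rightarrow> bool" where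
  "admissible B h \<longleftrightarrow> smooth B \<and> smooth h \<and> (\<forall>\<alpha>. d_dep \<alpha> B = (\<lambda>z. 0)) \<and> (\<forall>\<alpha>. d_dep \<alpha> h = (\<lambda>z. 0))
     \<and> d_indep Ix B = (\<lambda>z. 0) \<and> d_indep Iy B = (\<lambda>z. 0)
     \<and> (\<forall>z. w * transport h z = d_indep It B z) \<and> (\<forall>z. wave_op h z = 0)"

lemma sym_field_in_LSA: "admissible B h \<Longrightarrow> sym_field k B h \<in> LSA"
  unfolding lie_symmetry_iff admissible_def by (auto simp: smooth_sym_field L_sym_field is_sol_def)

section \<open>Reduction of an arbitrary symmetry to the normal form\<close>

context
  fixes X assumes X: "X \<in> LSA"
begin

lemmas smooth_X_components = smooth_xi_eta[OF X]
lemmas d_dep_X = d_dep_xi_fun[OF X] d_dep_eta_fun[OF X]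

lemma d_xi_diag: "d_indep Ix (xi X Ix) z = 0"
  using xi_eta_u[OF X, of z] xi_eta_v[OF X, of z] by linarith

lemma d_xi [simp]: "d_indep i (xi X k) = (\<lambda>z. 0)"
proof
  fix z
  have "d_indep Iy (xi X Ix) z = 0" for z
  proof (rule zero_off_hyperplane[where \<alpha> = Du])
    show "d_dep Du (d_indep Iy (xi X Ix)) = (\<lambda>z. 0)"
      by (simp add: d_dep_d_indep smooth_X_components d_dep_X)
    show "u_of z * d_indep Iy (xi X Ix) z = 0" for z
    proof -
      \<comment> \<open>Eliminating \<xi>^x_t between the wave equation and the transport operator
        leaves a multiple of d, which excludes the rotation.\<close>
      have "d_indep It (xi X Ix) z = - c * d_indep Iy (xi X Ix) z"
        using xi_t(1)[OF X, of z] by linarith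
      then have "d * (u_of z * d_indep Iy (xi X Ix) z) = 0"
        using xi_x_transport[OF X, of z] by (simp add: algebra_simps)
      then show ?thesis
        using d by simp
    qed
  qed (simp add: smooth_X_components smooth_d_indep)
  then show "d_indep i (xi X k) z = 0"
    using d_xi_diag[of z] xi_diag[OF X, of z] xi_relations[OF X, of z] xi_t[OF X, of z] a
    by (cases i; cases k) simp_all
qed

lemma xi_constant: "fst (X z) = fst (X 0)"
  using constant_if_partials_zero[OF smooth_X_components(1) d_xi d_dep_xi_fun[OF X]] by (simp add: vec_eq_iff)

lemmas jet_simps = L\<^sub>1_def L\<^sub>2_def L\<^sub>3_def eval_simps[OF X] d_dep_X axis_def

lemma eta_diag: "d_dep Dv (eta X Dv) z = d_dep Du (eta X Du) z"
  using xi_eta_u[OF X, of z] by simp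

lemma conditions_phi_t:
  "eta X Du z = u_of z * d_dep Du (eta X Du) z + v_of z * d_dep Dv (eta X Du) z - u_of z * d_dep Dphi (eta X Dphi) z"
  "eta X Dv z = u_of z * d_dep Du (eta X Dv) z + v_of z * d_dep Dv (eta X Dv) z - v_of z * d_dep Dphi (eta X Dphi) z"
proof -
  obtain r where r: "is_sol z 0 r"
    using is_sol_base_jet by blast
  \<comment> \<open>The value phi_t = 1 adds w m u and w m v to the two real Schroedinger equations;
    u_xx and v_xx balance it.\<close>
  have r': "is_sol z (axis Dphi (axis It 1))
      (r - (w * u_of z * m / a) *\<^sub>R mono2 Du Ix Ix - (w * v_of z * m / a) *\<^sub>R mono2 Dv Ix Ix)"
    using r a by (simp add: is_sol_def E\<^sub>1_def E\<^sub>2_def E\<^sub>3_def axis_def algebra_simps)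
  have "(w * m) * (u_of z * d_dep Du (eta X Du) z + v_of z * d_dep Dv (eta X Du) z - u_of z * d_dep Dphi (eta X Dphi) z
      - eta X Du z) = 0"
    using lie_symmetryD(1)[OF X r] lie_symmetryD(1)[OF X r'] a
    by (simp add: jet_simps algebra_simps)
  then show "eta X Du z = u_of z * d_dep Du (eta X Du) z + v_of z * d_dep Dv (eta X Du) z - u_of z * d_dep Dphi (eta X Dphi) z"
    using w m by simp
  have "(w * m) * (u_of z * d_dep Du (eta X Dv) z + v_of z * d_dep Dv (eta X Dv) z - v_of z * d_dep Dphi (eta X Dphi) z
      - eta X Dv z) = 0"
    using lie_symmetryD(2)[OF X r] lie_symmetryD(2)[OF X r'] a
    by (simp add: jet_simps algebra_simps)
  then show "eta X Dv z = u_of z * d_dep Du (eta X Dv) z + v_of z * d_dep Dv (eta X Dv) z - v_of z * d_dep Dphi (eta X Dphi) z"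
    using w m by simp
qed

lemma conditions_u_t:
  "d_dep Dv (eta X Du) z = - d_dep Du (eta X Dv) z"
  "eta X Du z = u_of z * d_dep Dphi (eta X Dphi) z - u_of z * d_dep Du (eta X Du) z - v_of z * d_dep Du (eta X Dv) z"
proof -
  obtain r where r: "is_sol z 0 r"
    using is_sol_base_jet by blast
  have r': "is_sol z (axis Du (axis It 1)) (r - (1 / a) *\<^sub>R mono2 Dv Ix Ix + (2 * m * u_of z) *\<^sub>R mono2 Dphi Ix Ix)"
    using r a by (simp add: is_sol_def E\<^sub>1_def E\<^sub>2_def E\<^sub>3_def axis_def algebra_simps)
  show "d_dep Dv (eta X Du) z = - d_dep Du (eta X Dv) z"
    using lie_symmetryD(1)[OF X r] lie_symmetryD(1)[OF X r'] a
    by (simp add: jet_simps algebra_simps)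
  have "(2 * m) * (u_of z * d_dep Dphi (eta X Dphi) z - u_of z * d_dep Du (eta X Du) z
      - v_of z * d_dep Du (eta X Dv) z - eta X Du z) = 0"
    using lie_symmetryD(3)[OF X r] lie_symmetryD(3)[OF X r'] a
    by (simp add: jet_simps algebra_simps)
  then show "eta X Du z = u_of z * d_dep Dphi (eta X Dphi) z - u_of z * d_dep Du (eta X Du) z
      - v_of z * d_dep Du (eta X Dv) z"
    using m by simp
qed

lemma conditions_v_t:
  "eta X Dv z = v_of z * d_dep Dphi (eta X Dphi) z - u_of z * d_dep Dv (eta X Du) z - v_of z * d_dep Dv (eta X Dv) z"
proof -
  obtain r where r: "is_sol z 0 r"
    using is_sol_base_jet by blast
  have r': "is_sol z (axis Dv (axis It 1)) (r + (1 / a) *\<^sub>R mono2 Du Ix Ix + (2 * m * v_of z) *\<^sub>R mono2 Dphi Ix Ix)"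
    using r a by (simp add: is_sol_def E\<^sub>1_def E\<^sub>2_def E\<^sub>3_def axis_def algebra_simps)
  have "(2 * m) * (v_of z * d_dep Dphi (eta X Dphi) z - u_of z * d_dep Dv (eta X Du) z
      - v_of z * d_dep Dv (eta X Dv) z - eta X Dv z) = 0"
    using lie_symmetryD(3)[OF X r] lie_symmetryD(3)[OF X r'] a
    by (simp add: jet_simps algebra_simps)
  then show ?thesis
    using m by simp
qed

lemma conditions_v_x: "d_dep Dv (d_dep Dv (eta X Du)) z = 0"
proof -
  obtain r where r: "is_sol z 0 r"
    using is_sol_base_jet by blast
  have r': "is_sol z (axis Dv (axis Ix s)) r" for s
    using r by (simp add: is_sol_def E\<^sub>1_def E\<^sub>2_def E\<^sub>3_def axis_def)
  \<comment> \<open>As v_x occurs in no equation, the same second derivatives serve for every s. The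
    condition is a quadratic polynomial in s, and s = 1 and s = -1 separate its linear and quadratic
    parts.\<close>
  have "L\<^sub>1 z (axis Dv (axis Ix s)) (X z) (pr1 X z (axis Dv (axis Ix s))) (pr2 X z (axis Dv (axis Ix s)) r)
      = L\<^sub>1 z 0 (X z) (pr1 X z 0) (pr2 X z 0 r)
        + s * (a * (2 * d_indep Ix (d_dep Dv (eta X Du)) z + s * d_dep Dv (d_dep Dv (eta X Du)) z))" for s
    by (simp add: jet_simps algebra_simps)
  from this[of 1] this[of "- 1"]
  have "a * (2 * d_indep Ix (d_dep Dv (eta X Du)) z + d_dep Dv (d_dep Dv (eta X Du)) z) = 0"
    "a * (2 * d_indep Ix (d_dep Dv (eta X Du)) z - d_dep Dv (d_dep Dv (eta X Du)) z) = 0"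
    by (simp_all add: lie_symmetryD(1)[OF X r] lie_symmetryD(1)[OF X r'])
  then show ?thesis
    using a by simp
qed

lemma conditions_u_x:
  "d_dep Du (d_dep Du (eta X Dv)) z = 0" "d_indep Ix (d_dep Du (eta X Dv)) z = 0"
proof -
  obtain r where r: "is_sol z 0 r"
    using is_sol_base_jet by blast
  have r': "is_sol z (axis Du (axis Ix s)) r" for s
    using r by (simp add: is_sol_def E\<^sub>1_def E\<^sub>2_def E\<^sub>3_def axis_def)
  have "L\<^sub>2 z (axis Du (axis Ix s)) (X z) (pr1 X z (axis Du (axis Ix s))) (pr2 X z (axis Du (axis Ix s)) r)
      = L\<^sub>2 z 0 (X z) (pr1 X z 0) (pr2 X z 0 r)
        + s * (a * (2 * d_indep Ix (d_dep Du (eta X Dv)) z + s * d_dep Du (d_dep Du (eta X Dv)) z))" for s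
    by (simp add: jet_simps algebra_simps)
  from this[of 1] this[of "- 1"]
  have "a * (2 * d_indep Ix (d_dep Du (eta X Dv)) z + d_dep Du (d_dep Du (eta X Dv)) z) = 0"
    "a * (2 * d_indep Ix (d_dep Du (eta X Dv)) z - d_dep Du (d_dep Du (eta X Dv)) z) = 0"
    by (simp_all add: lie_symmetryD(2)[OF X r] lie_symmetryD(2)[OF X r'])
  then show "d_dep Du (d_dep Du (eta X Dv)) z = 0" "d_indep Ix (d_dep Du (eta X Dv)) z = 0"
    using a by simp_all
qed

lemma conditions_u_y: "d_indep Iy (d_dep Du (eta X Dv)) z = 0"
proof -
  obtain r where r: "is_sol z 0 r"
    using is_sol_base_jet by blast
  \<comment> \<open>Unlike u_x, the derivative u_y occurs in the wave equation and is balanced there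
    in phi_xx.\<close>
  define r' where "r' s = r + (2 * (m * c - d) * u_of z * s) *\<^sub>R mono2 Dphi Ix Ix" for s
  have r': "is_sol z (axis Du (axis Iy s)) (r' s)" for s
    using r by (simp add: r'_def is_sol_def E\<^sub>1_def E\<^sub>2_def E\<^sub>3_def axis_def)
  have "L\<^sub>2 z (axis Du (axis Iy s)) (X z) (pr1 X z (axis Du (axis Iy s))) (pr2 X z (axis Du (axis Iy s)) (r' s))
      = L\<^sub>2 z 0 (X z) (pr1 X z 0) (pr2 X z 0 r)
        + s * (\<epsilon>\<^sub>0 * (2 * d_indep Iy (d_dep Du (eta X Dv)) z + s * d_dep Du (d_dep Du (eta X Dv)) z))" for s
    by (simp add: r'_def jet_simps algebra_simps)
  from this[of 1] this[of "- 1"]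
  have "\<epsilon>\<^sub>0 * (2 * d_indep Iy (d_dep Du (eta X Dv)) z + d_dep Du (d_dep Du (eta X Dv)) z) = 0"
    "\<epsilon>\<^sub>0 * (2 * d_indep Iy (d_dep Du (eta X Dv)) z - d_dep Du (d_dep Du (eta X Dv)) z) = 0"
    by (simp_all add: lie_symmetryD(2)[OF X r] lie_symmetryD(2)[OF X r'])
  then show ?thesis
    using eps by simp
qed

abbreviation rotation :: "brzr_point \<Rightarrow> real" where
  "rotation \<equiv> d_dep Du (eta X Dv)"

lemma smooth_rotation: "smooth rotation"
  by (simp add: smooth_d_dep smooth_X_components)

text \<open>The u-component is known in two ways, from \<open>conditions_phi_t\<close> and from
  \<open>conditions_u_t\<close>. Their diagonal terms u (\<eta>^u_u - \<eta>^phi_phi) have opposite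
  signs, so the sum contains only the off-diagonal derivatives, and these are antisymmetric. The
  v-component is analogous.\<close>

lemma eta_u: "eta X Du = (\<lambda>z. v_of z * (- rotation z))"
  and eta_v: "eta X Dv = (\<lambda>z. u_of z * rotation z)"
proof -
  show "eta X Du = (\<lambda>z. v_of z * (- rotation z))"
  proof
    show "eta X Du z = v_of z * (- rotation z)" for z
      using conditions_phi_t(1)[of z] conditions_u_t[of z] eta_diag[of z] by simp
  qed
  show "eta X Dv = (\<lambda>z. u_of z * rotation z)"
  proof
    show "eta X Dv z = u_of z * rotation z" for z
      using conditions_phi_t(2)[of z] conditions_v_t[of z] conditions_u_t(1)[of z] eta_diag[of z] by simp
  qed
qed

lemma d_rotation:
  "d_indep Ix rotation = (\<lambda>z. 0)" "d_indep Iy rotation = (\<lambda>z. 0)" "d_dep \<alpha> rotation = (\<lambda>z. 0)"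
proof -
  show "d_indep Ix rotation = (\<lambda>z. 0)" "d_indep Iy rotation = (\<lambda>z. 0)"
    using conditions_u_x(2) conditions_u_y by auto
  have "d_dep Dphi rotation = (\<lambda>z. 0)"
    by (simp add: d_dep_commute[of _ Dphi Du] smooth_X_components d_dep_X)
  moreover have "d_dep Du rotation = (\<lambda>z. 0)"
    using conditions_u_x(1) by auto
  moreover have "d_dep Dv rotation = (\<lambda>z. 0)"
  proof -
    \<comment> \<open>By antisymmetry the rate is also -\<eta>^u_v, whose v-derivative vanishes by
      \<open>conditions_v_x\<close>.\<close>
    have "rotation = (\<lambda>z. - d_dep Dv (eta X Du) z)"
      using conditions_u_t(1) by auto
    then have "d_dep Dv rotation = (\<lambda>z. - d_dep Dv (d_dep Dv (eta X Du)) z)"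
      unfolding d_dep_def
      using dirderiv_bounded_linear_comp[OF smooth_dirderiv[OF smooth_X_components(2)] bounded_linear_minus[OF bounded_linear_ident]]
      by simp
    then show ?thesis
      using conditions_v_x by simp
  qed
  ultimately show "d_dep \<alpha> rotation = (\<lambda>z. 0)"
    by (cases \<alpha>) simp_all
qed

text \<open>Once the u- and v-components are a pure rotation, \<eta>^u_u = 0, and
  \<open>conditions_phi_t\<close> and \<open>conditions_u_t\<close> reduce to u \<eta>^phi_phi = 0.
  So phi cannot be rescaled.\<close>

lemma d_dep_phi: "d_dep \<alpha> (eta X Dphi) = (\<lambda>z. 0)"
proof -
  have "d_dep Dphi (eta X Dphi) z = 0" for z
  proof (rule zero_off_hyperplane[where \<alpha> = Du])
    show "d_dep Du (d_dep Dphi (eta X Dphi)) = (\<lambda>z. 0)"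
      by (simp add: d_dep_commute[of _ Du Dphi] smooth_X_components d_dep_X)
    have "d_dep Dv (eta X Dv) = (\<lambda>z. 0)"
      by (subst eta_v) (simp add: d_coord_mult smooth_rotation d_rotation)
    then have "d_dep Du (eta X Du) z = 0" for z
      using eta_diag[of z] by simp
    then show "u_of z * d_dep Dphi (eta X Dphi) z = 0" for z
      using conditions_phi_t(1)[of z] conditions_u_t[of z] eta_diag[of z] by simp
  qed (simp add: smooth_X_components smooth_d_dep)
  then show ?thesis
    by (cases \<alpha>) (simp_all add: d_dep_X fun_eq_iff)
qed

lemma LSA_imp_sym_field: "\<exists>B h. admissible B h \<and> X = sym_field (fst (X 0)) B h"
proof -
  define B where "B = rotation"
  define h where "h = eta X Dphi"
  have B: "smooth B" "\<And>\<alpha>. d_dep \<alpha> B = (\<lambda>z. 0)" "d_indep Ix B = (\<lambda>z. 0)" "d_indep Iy B = (\<lambda>z. 0)"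
    unfolding B_def by (rule smooth_rotation d_rotation)+
  have h: "smooth h" "\<And>\<alpha>. d_dep \<alpha> h = (\<lambda>z. 0)"
    unfolding h_def by (rule smooth_xi_eta[OF X] d_dep_phi)+
  have X_eq: "X = sym_field (fst (X 0)) B h"
  proof
    fix z
    have "snd (X z) = snd (sym_field (fst (X 0)) B h z)"
      unfolding vec_eq_iff
    proof
      show "snd (X z) $ \<alpha> = snd (sym_field (fst (X 0)) B h z) $ \<alpha>" for \<alpha>
        using fun_cong[OF eta_u, of z] fun_cong[OF eta_v, of z] by (cases \<alpha>) (simp_all add: B_def h_def)
    qed
    then show "X z = sym_field (fst (X 0)) B h z"
      using xi_constant[of z] by (simp add: prod_eq_iff)
  qed
  have 1: "u_of z * (w * transport h z - d_indep It B z) = 0" for z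
    using lie_symmetryD(1)[OF X is_sol_base_jet, of z 0] L_sym_field(1)[OF B h, of z 0 "fst (X 0)"]
      is_sol_base_jet[of z 0]
    by (simp add: X_eq[symmetric] is_sol_def)
  have "w * transport h z = d_indep It B z" for z
  proof -
    \<comment> \<open>At this point u = 1, while the derivatives of \<open>B\<close> and
      \<open>h\<close> are the same as at z; this removes the factor u.\<close>
    let ?z = "z + (1 - u_of z) *\<^sub>R pd_u"
    have c: "f ?z = f z" if "smooth f" "d_dep Du f = (\<lambda>z. 0)" for f
      using that by (intro constant_along) (auto simp: d_dep_def)
    have "d_indep i B ?z = d_indep i B z" "d_indep i h ?z = d_indep i h z" for i
      by (rule c; simp add: smooth_d_indep B h d_dep_d_indep)+
    then show ?thesis
      using 1[of ?z] by (simp add: transport_def)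
  qed
  moreover have "wave_op h z = 0" for z
    using lie_symmetryD(3)[OF X is_sol_base_jet, of z 0] L_sym_field(3)[OF B h, of z 0 "fst (X 0)"]
    by (simp add: X_eq[symmetric])
  ultimately have "admissible B h"
    unfolding admissible_def using B h by blast
  then show ?thesis
    using X_eq by blast
qed

end
end

section \<open>Solving the equations for the phase rate and the shift\<close>

lemma smooth_cmult:
  fixes f :: "'a::euclidean_space \<Rightarrow> real"
  shows "smooth f \<Longrightarrow> smooth (\<lambda>z. x * f z)"
  by (rule smooth_mult[OF smooth_const])

lemma d_add:
  assumes "smooth f" "smooth g"
  shows "d_indep i (\<lambda>z. f z + g z) = (\<lambda>z. d_indep i f z + d_indep i g z)"
    and "d_dep \<alpha> (\<lambda>z. f z + g z) = (\<lambda>z. d_dep \<alpha> f z + d_dep \<alpha> g z)"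
  unfolding d_indep_def d_dep_def by (rule dirderiv_add[OF assms])+

lemma d_cmult:
  assumes "smooth f"
  shows "d_indep i (\<lambda>z. x * f z) = (\<lambda>z. x * d_indep i f z)"
    and "d_dep \<alpha> (\<lambda>z. x * f z) = (\<lambda>z. x * d_dep \<alpha> f z)"
  unfolding d_indep_def d_dep_def by (simp_all add: dirderiv_mult[OF smooth_const assms])

lemma d_coord_indep:
  fixes f :: "('i::finite, 'd::finite) jet0 \<Rightarrow> real"
  assumes "smooth f"
  shows "d_indep i (\<lambda>z. fst z $ j * f z) = (\<lambda>z. (if i = j then f z else 0) + fst z $ j * d_indep i f z)"
    and "d_dep \<beta> (\<lambda>z. fst z $ j * f z) = (\<lambda>z. fst z $ j * d_dep \<beta> f z)"
    and "d_indep i (\<lambda>z::('i, 'd) jet0. fst z $ j) = (\<lambda>z. if i = j then 1 else 0)"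
    and "d_dep \<beta> (\<lambda>z::('i, 'd) jet0. fst z $ j) = (\<lambda>z. 0)"
proof -
  have bl: "bounded_linear (\<lambda>z::('i, 'd) jet0. fst z $ j)"
    by (intro bounded_linear_compose[OF bounded_linear_vec_nth] bounded_linear_fst)
  show "d_indep i (\<lambda>z. fst z $ j * f z) = (\<lambda>z. (if i = j then f z else 0) + fst z $ j * d_indep i f z)"
    and "d_dep \<beta> (\<lambda>z. fst z $ j * f z) = (\<lambda>z. fst z $ j * d_dep \<beta> f z)"
    and "d_indep i (\<lambda>z::('i, 'd) jet0. fst z $ j) = (\<lambda>z. if i = j then 1 else 0)"
    and "d_dep \<beta> (\<lambda>z::('i, 'd) jet0. fst z $ j) = (\<lambda>z. 0)"
    unfolding d_indep_def d_dep_def dirderiv_mult[OF smooth_coord(1) assms] dirderiv_bounded_linear[OF bl]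
    by (auto simp: fun_eq_iff axis_def)
qed

lemmas d_coord = d_coord_indep(3,4)[OF smooth_const[of 0]]

lemmas smooth_rules = smooth_const smooth_coord smooth_add smooth_mult smooth_cmult smooth_d_indep smooth_d_dep

text \<open>Letters for the coefficients: two operators with constant coefficients commute whatever
  the constants are, and terms such as 1 - m c^2 stay out of the computation.\<close>

definition coeff_wave_op :: "real \<Rightarrow> real \<Rightarrow> real \<Rightarrow> (brzr_point \<Rightarrow> real) \<Rightarrow> brzr_point \<Rightarrow> real" where
  "coeff_wave_op p q r h = (\<lambda>z. d_indep Ix (d_indep Ix h) z + (p * d_indep Iy (d_indep Iy h) z
     + (q * d_indep It (d_indep It h) z + r * d_indep It (d_indep Iy h) z)))"

definition coeff_transport :: "real \<Rightarrow> real \<Rightarrow> (brzr_point \<Rightarrow> real) \<Rightarrow> brzr_point \<Rightarrow> real" where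
  "coeff_transport p q h = (\<lambda>z. p * d_indep It h z + q * d_indep Iy h z)"

lemma coeff_wave_op_transport_op:
  assumes "smooth h"
  shows "coeff_wave_op p q r (coeff_transport s t h) z = coeff_transport s t (coeff_wave_op p q r h) z"
  unfolding coeff_wave_op_def coeff_transport_def
  by (simp add: d_add d_cmult smooth_rules assms
      d_indep_commute[of _ Ix It] d_indep_commute[of _ Iy It] d_indep_commute[of _ Iy Ix])
    (simp add: algebra_simps)

lemma quadratic_in_t:
  fixes B :: "brzr_point \<Rightarrow> real"
  assumes B: "smooth B" "\<And>\<alpha>. d_dep \<alpha> B = (\<lambda>z. 0)" "d_indep Ix B = (\<lambda>z. 0)" "d_indep Iy B = (\<lambda>z. 0)"
    and Bttt: "d_indep It (d_indep It (d_indep It B)) = (\<lambda>z. 0)"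
  shows "\<exists>\<beta>\<^sub>0 \<beta>\<^sub>1 \<beta>\<^sub>2. B = (\<lambda>z. \<beta>\<^sub>0 + \<beta>\<^sub>1 * t_of z + \<beta>\<^sub>2 * (t_of z * t_of z))"
proof -
  have const: "f z = f 0" if "smooth f" "\<And>\<alpha>. d_dep \<alpha> f = (\<lambda>z. 0)" "d_indep Ix f = (\<lambda>z. 0)"
      "d_indep Iy f = (\<lambda>z. 0)" "d_indep It f = (\<lambda>z. 0)" for f :: "brzr_point \<Rightarrow> real" and z
  proof (rule constant_if_partials_zero[OF that(1)])
    show "d_indep i f = (\<lambda>z. 0)" for i
      using that by (cases i) simp_all
  qed (rule that)
  \<comment> \<open>With this sign, and likewise for \<open>p\<close> below, the corrected functions
    \<open>g\<close> and \<open>h\<close> are sums all of whose partial derivatives vanish.\<close>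
  define q where "q = - d_indep It (d_indep It B) 0"
  have "d_indep It (d_indep It B) z = d_indep It (d_indep It B) 0" for z
  proof (rule const)
    show "d_indep Ix (d_indep It (d_indep It B)) = (\<lambda>z. 0)"
      by (simp add: d_indep_commute[of _ Ix It] smooth_d_indep B)
    show "d_indep Iy (d_indep It (d_indep It B)) = (\<lambda>z. 0)"
      by (simp add: d_indep_commute[of _ Iy It] smooth_d_indep B)
  qed (simp_all add: d_dep_d_indep smooth_d_indep B Bttt)
  then have Btt: "d_indep It (d_indep It B) z = - q" for z
    by (simp add: q_def)
  define g where "g = (\<lambda>z. d_indep It B z + q * t_of z)"
  define p where "p = - g 0"
  have "g z = g 0" for z
  proof (rule const)
    show "smooth g"
      unfolding g_def by (intro smooth_rules B)
  qed (simp_all add: g_def d_add d_cmult d_coord smooth_rules B d_dep_d_indep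
      d_indep_commute[of _ Ix It] d_indep_commute[of _ Iy It] Btt)
  then have g: "g z = - p" for z
    by (simp add: p_def)
  define r where "r = q / 2"
  have q: "q = 2 * r"
    by (simp add: r_def)
  define h where "h = (\<lambda>z. B z + (p * t_of z + r * (t_of z * t_of z)))"
  have "h z = h 0" for z
  proof (rule const)
    show "smooth h"
      unfolding h_def by (intro smooth_rules B)
    show "d_indep It h = (\<lambda>z. 0)"
      using g by (simp add: q h_def g_def d_add d_cmult d_coord d_coord_indep smooth_rules B fun_eq_iff
          algebra_simps)
  qed (simp_all add: h_def d_add d_cmult d_coord d_coord_indep smooth_rules B)
  then have "B = (\<lambda>z. h 0 + (- p) * t_of z + (- r) * (t_of z * t_of z))"
    by (simp add: h_def fun_eq_iff algebra_simps)
  then show ?thesis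
    by blast
qed

context brzr
begin

lemma wave_op_transport_commute:
  assumes h: "smooth h"
  shows "wave_op (transport h) z = transport (wave_op h) z"
proof -
  have wave_op': "wave_op = coeff_wave_op (1 - m * c\<^sup>2) (- m) (- 2 * m * c)"
    by (simp add: fun_eq_iff wave_op_def coeff_wave_op_def)
  have transport': "transport = coeff_transport m (m * c - d)"
    by (simp add: fun_eq_iff transport_def coeff_transport_def)
  show ?thesis
    unfolding wave_op' transport' by (rule coeff_wave_op_transport_op[OF h])
qed

lemma smooth_transport: "smooth h \<Longrightarrow> smooth (transport h)"
  unfolding transport_def[abs_def] by (intro smooth_rules)

lemma wave_op_add: "smooth f \<Longrightarrow> smooth g \<Longrightarrow> wave_op (\<lambda>z. f z + g z) z = wave_op f z + wave_op g z"
  by (simp add: wave_op_def d_add smooth_rules algebra_simps)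

lemma wave_op_cmult: "smooth f \<Longrightarrow> wave_op (\<lambda>z. x * f z) z = x * wave_op f z"
  by (simp add: wave_op_def d_cmult smooth_rules algebra_simps)

lemma transport_add: "smooth f \<Longrightarrow> smooth g \<Longrightarrow> transport (\<lambda>z. f z + g z) z = transport f z + transport g z"
  by (simp add: transport_def d_add smooth_rules algebra_simps)

lemma transport_cmult: "smooth f \<Longrightarrow> transport (\<lambda>z. x * f z) z = x * transport f z"
  by (simp add: transport_def d_cmult smooth_rules algebra_simps)

lemma admissible_add:
  "admissible B h \<Longrightarrow> admissible B' h' \<Longrightarrow> admissible (\<lambda>z. B z + B' z) (\<lambda>z. h z + h' z)"
  unfolding admissible_def
  by (simp add: smooth_add d_add wave_op_add transport_add distrib_left)

lemma admissible_cmult: "admissible B h \<Longrightarrow> admissible (\<lambda>z. x * B z) (\<lambda>z. x * h z)"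
  unfolding admissible_def
  by (simp add: smooth_cmult d_cmult wave_op_cmult transport_cmult)

text \<open>The shift B/(m w) solves the transport equation, but the wave operator maps it to -2
  \<beta>/w, where \<beta> is the coefficient of t^2. The summand (\<beta>/w) x^2 restores the wave
  equation and is invisible to the transport operator. This is the x^2 term of
  \<open>\<X>\<^sub>6\<close>.\<close>

lemma admissible_quadratic:
  "admissible (\<lambda>z. \<beta>\<^sub>0 + \<beta>\<^sub>1 * t_of z + \<beta>\<^sub>2 * (t_of z * t_of z))
    (\<lambda>z. (1 / (m * w)) * (\<beta>\<^sub>0 + \<beta>\<^sub>1 * t_of z + \<beta>\<^sub>2 * (t_of z * t_of z)) + (\<beta>\<^sub>2 / w) * (x_of z * x_of z))"
proof -
  define p q where pq: "p = 1 / (m * w)" "q = \<beta>\<^sub>2 / w"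
  show ?thesis
    using m w unfolding admissible_def wave_op_def transport_def pq[symmetric]
    by (simp add: d_add d_cmult d_coord d_coord_indep smooth_rules) (simp add: pq field_simps)
qed

text \<open>On functions of t alone the wave operator is -m times the second derivative. Applied to
  B' = w \<open>transport h\<close> it gives -m B'''; commuting the operators gives w
  \<open>transport (wave_op h)\<close>, which is 0.\<close>

lemma admissible_B_ttt:
  assumes "admissible B h"
  shows "d_indep It (d_indep It (d_indep It B)) z = 0"
proof -
  have sm: "smooth B" "smooth h" and B: "d_indep Ix B = (\<lambda>z. 0)" "d_indep Iy B = (\<lambda>z. 0)"
    using assms by (auto simp: admissible_def)
  have wt: "(\<lambda>z. w * transport h z) = d_indep It B" and bh: "wave_op h = (\<lambda>z. 0)"
    using assms by (auto simp: admissible_def)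
  have "wave_op (d_indep It B) z = w * wave_op (transport h) z"
    unfolding wt[symmetric] by (rule wave_op_cmult[OF smooth_transport[OF sm(2)]])
  also have "\<dots> = 0"
    unfolding wave_op_transport_commute[OF sm(2)] bh by (simp add: transport_def)
  finally have "m * d_indep It (d_indep It (d_indep It B)) z = 0"
    by (simp add: wave_op_def d_indep_commute[of _ Ix It] d_indep_commute[of _ Iy It] sm B smooth_rules)
  then show ?thesis
    using m by simp
qed

text \<open>The coefficients \<open>K\<close> for which the shift of phi by \<open>K\<close> alone
  is a symmetry.\<close>

definition wave :: "(brzr_point \<Rightarrow> real) \<Rightarrow> bool" where
  "wave K \<longleftrightarrow> smooth K \<and> (\<forall>\<alpha>. d_dep \<alpha> K = (\<lambda>z. 0)) \<and> (\<forall>z. transport K z = 0) \<and> (\<forall>z. wave_op K z = 0)"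

lemma admissible_0_iff: "admissible (\<lambda>z. 0) K \<longleftrightarrow> wave K"
  using w by (auto simp: admissible_def wave_def)

lemma admissible_cases:
  assumes "admissible B h"
  obtains \<beta>\<^sub>0 \<beta>\<^sub>1 \<beta>\<^sub>2 K where "wave K"
    "B = (\<lambda>z. \<beta>\<^sub>0 + \<beta>\<^sub>1 * t_of z + \<beta>\<^sub>2 * (t_of z * t_of z))"
    "h = (\<lambda>z. (1 / (m * w)) * (\<beta>\<^sub>0 + \<beta>\<^sub>1 * t_of z + \<beta>\<^sub>2 * (t_of z * t_of z)) + (\<beta>\<^sub>2 / w) * (x_of z * x_of z) + K z)"
proof -
  obtain \<beta>\<^sub>0 \<beta>\<^sub>1 \<beta>\<^sub>2 where B: "B = (\<lambda>z. \<beta>\<^sub>0 + \<beta>\<^sub>1 * t_of z + \<beta>\<^sub>2 * (t_of z * t_of z))"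
    using quadratic_in_t[of B] assms admissible_B_ttt[OF assms] unfolding admissible_def by blast
  let ?g = "\<lambda>z. (1 / (m * w)) * (\<beta>\<^sub>0 + \<beta>\<^sub>1 * t_of z + \<beta>\<^sub>2 * (t_of z * t_of z)) + (\<beta>\<^sub>2 / w) * (x_of z * x_of z)"
  have "wave (\<lambda>z. h z + (- 1) * ?g z)"
    using admissible_add[OF assms admissible_cmult[OF admissible_quadratic, of "- 1" \<beta>\<^sub>0 \<beta>\<^sub>1 \<beta>\<^sub>2]]
    unfolding admissible_0_iff[symmetric] B by simp
  moreover have "h = (\<lambda>z. ?g z + (h z + (- 1) * ?g z))"
    by simp
  ultimately show thesis
    using that B by blast
qed

end

section \<open>Wave-type equations in two variables\<close>

lemma dirderiv_scaled:
  fixes f :: "'a::euclidean_space \<Rightarrow> 'b::real_normed_vector"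
  shows "smooth f \<Longrightarrow> dirderiv (x *\<^sub>R v) f z = x *\<^sub>R dirderiv v f z"
  by (rule linear_cmul[OF linear_dirderiv])

lemma dirderiv_sum2:
  fixes f :: "'a::euclidean_space \<Rightarrow> 'b::real_normed_vector"
  shows "smooth f \<Longrightarrow> dirderiv (v + w) f z = dirderiv v f z + dirderiv w f z"
  by (rule linear_add[OF linear_dirderiv])

lemma dirderiv_real: "smooth f \<Longrightarrow> dirderiv x f z = x *\<^sub>R dirderiv 1 f z" for x :: real
  using dirderiv_scaled[of f x 1 z] by simp

lemma dirderiv_zero: "smooth f \<Longrightarrow> dirderiv 0 f = (\<lambda>z. 0)"
  using linear_0[OF linear_dirderiv] by (auto simp: fun_eq_iff)

lemma dirderiv_diff:
  assumes "smooth f" "smooth g"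
  shows "dirderiv v (\<lambda>x. f x - g x) = (\<lambda>x. dirderiv v f x - dirderiv v g x)"
  using dirderiv_eqI[OF has_derivative_diff[OF assms[THEN smooth_has_derivative]]]
  by (simp add: fun_eq_iff)

lemma smooth_diff:
  assumes "smooth f" "smooth g"
  shows "smooth (\<lambda>x. f x - g x)"
  using smooth_add[OF assms(1) smooth_bounded_linear_comp[OF assms(2) bounded_linear_minus[OF bounded_linear_ident]]]
  by simp

text \<open>The increment of \<open>f\<close> along \<open>v\<close> is constant along
  \<open>w\<close>, because its \<open>w\<close>-derivative is an increment along \<open>v\<close>
  of a function that is constant along \<open>v\<close>. This splits \<open>f\<close> into functions
  of one characteristic coordinate each.\<close>

lemma dalembert:
  fixes f :: "'a::euclidean_space \<Rightarrow> real"
  assumes "smooth f" "dirderiv v (dirderiv w f) = (\<lambda>z. 0)"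
  shows "f (s *\<^sub>R v + t *\<^sub>R w) = f (s *\<^sub>R v) + f (t *\<^sub>R w) - f 0"
proof -
  define P where "P = (\<lambda>q. f (q + s *\<^sub>R v) - f q)"
  have s: "smooth (\<lambda>q. f (q + s *\<^sub>R v))"
    using smooth_linear_compose[OF assms(1) bounded_linear_ident bounded_linear_ident] .
  have "dirderiv w P q = 0" for q
  proof -
    have "dirderiv w P q = dirderiv w f (q + s *\<^sub>R v) - dirderiv w f q"
      unfolding P_def
      using dirderiv_linear_compose[OF assms(1) bounded_linear_ident bounded_linear_ident]
      by (simp add: dirderiv_diff s assms(1))
    also have "\<dots> = 0"
      using constant_along[OF smooth_dirderiv[OF assms(1)]] assms(2) by simp
    finally show ?thesis .
  qed
  moreover have "smooth P"
    unfolding P_def by (intro smooth_diff s assms(1))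
  ultimately have "P (0 + t *\<^sub>R w) = P 0"
    using constant_along by blast
  then show ?thesis
    by (simp add: P_def algebra_simps)
qed

lemma affine_along:
  fixes f :: "'a::euclidean_space \<Rightarrow> real"
  assumes "smooth f" "dirderiv v (dirderiv v f) = (\<lambda>z. 0)"
  shows "f (z + s *\<^sub>R v) = f z + s * dirderiv v f z"
proof -
  have "((\<lambda>s. f (z + s *\<^sub>R v) - s * dirderiv v f z) has_derivative (\<lambda>h. 0)) (at r)" for r
  proof -
    have "((\<lambda>s. f (z + s *\<^sub>R v) - s * dirderiv v f z) has_vector_derivative
        dirderiv v f (z + r *\<^sub>R v) - 1 * dirderiv v f z) (at r)"
      by (intro has_vector_derivative_diff dirderiv_along_line assms
          has_vector_derivative_mult_left has_vector_derivative_id)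
    moreover have "dirderiv v f (z + r *\<^sub>R v) = dirderiv v f z"
      by (rule constant_along) (simp_all add: assms smooth_dirderiv)
    ultimately show ?thesis
      by (simp add: has_vector_derivative_def)
  qed
  from has_derivative_zero_unique[of UNIV "\<lambda>s. f (z + s *\<^sub>R v) - s * dirderiv v f z" s 0, OF _ this]
  show ?thesis by simp
qed

lemma harmonic_iff:
  "harmonic H \<longleftrightarrow> smooth H \<and>
    (\<forall>q. dirderiv (1, 0) (dirderiv (1, 0) H) q + dirderiv (0, 1) (dirderiv (0, 1) H) q = 0)"
proof -
  have x: "deriv (\<lambda>x'. f (x', s)) = (\<lambda>x. dirderiv (1, 0) f (x, s))"
    if "smooth f" for f :: "real \<times> real \<Rightarrow> real" and s
    using dirderiv_along_line[OF that, of "(0, s)" "(1, 0)"]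
    by (intro ext DERIV_imp_deriv) (simp add: has_real_derivative_iff_has_vector_derivative)
  have y: "deriv (\<lambda>s'. f (x, s')) = (\<lambda>s. dirderiv (0, 1) f (x, s))"
    if "smooth f" for f :: "real \<times> real \<Rightarrow> real" and x
    using dirderiv_along_line[OF that, of "(x, 0)" "(0, 1)"]
    by (intro ext DERIV_imp_deriv) (simp add: has_real_derivative_iff_has_vector_derivative)
  have "smooth H \<Longrightarrow> deriv (deriv (\<lambda>x'. H (x', s))) x + deriv (deriv (\<lambda>s'. H (x, s'))) s
      = dirderiv (1, 0) (dirderiv (1, 0) H) (x, s) + dirderiv (0, 1) (dirderiv (0, 1) H) (x, s)" for x s
    by (simp add: x y smooth_dirderiv)
  then show ?thesis
    unfolding harmonic_def by auto
qed

context brzr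
begin

text \<open>Coordinates constant along the transport field. The factor \<rho> adapts them to the
  three cases: 1 for the travelling waves, 1 / sqrt (m (m - d^2)) to reach the Laplace equation, and
  1/d for m = d^2, where m y - (m c - d) t = d (d y - (c d - 1) t).\<close>

definition plane :: "real \<Rightarrow> brzr_point \<Rightarrow> real \<times> real" where
  "plane \<rho> z = (x_of z, \<rho> * (m * y_of z - (m * c - d) * t_of z))"

lemma bounded_linear_plane: "bounded_linear (plane \<rho>)"
  unfolding plane_def[abs_def]
  by (intro bounded_linear_Pair bounded_linear_const_mult bounded_linear_sub
      bounded_linear_compose[OF bounded_linear_vec_nth] bounded_linear_fst)

lemma d_plane:
  assumes "smooth H"
  shows "d_indep Ix (\<lambda>z. H (plane \<rho> z)) = (\<lambda>z. dirderiv (1, 0) H (plane \<rho> z))"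
    and "d_indep Iy (\<lambda>z. H (plane \<rho> z)) = (\<lambda>z. (\<rho> * m) *\<^sub>R dirderiv (0, 1) H (plane \<rho> z))"
    and "d_indep It (\<lambda>z. H (plane \<rho> z)) = (\<lambda>z. (- \<rho> * (m * c - d)) *\<^sub>R dirderiv (0, 1) H (plane \<rho> z))"
    and "d_dep \<alpha> (\<lambda>z. H (plane \<rho> z)) = (\<lambda>z. 0)"
proof -
  have "plane \<rho> (axis Ix 1, 0) = (1, 0)" "plane \<rho> (axis Iy 1, 0) = (\<rho> * m) *\<^sub>R (0, 1)"
    "plane \<rho> (axis It 1, 0) = (- \<rho> * (m * c - d)) *\<^sub>R (0, 1)" "plane \<rho> (0, axis \<alpha> 1) = 0" for \<alpha>
    by (simp_all add: plane_def axis_def zero_prod_def algebra_simps)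
  then show "d_indep Ix (\<lambda>z. H (plane \<rho> z)) = (\<lambda>z. dirderiv (1, 0) H (plane \<rho> z))"
    and "d_indep Iy (\<lambda>z. H (plane \<rho> z)) = (\<lambda>z. (\<rho> * m) *\<^sub>R dirderiv (0, 1) H (plane \<rho> z))"
    and "d_indep It (\<lambda>z. H (plane \<rho> z)) = (\<lambda>z. (- \<rho> * (m * c - d)) *\<^sub>R dirderiv (0, 1) H (plane \<rho> z))"
    and "d_dep \<alpha> (\<lambda>z. H (plane \<rho> z)) = (\<lambda>z. 0)"
    unfolding d_indep_def d_dep_def dirderiv_comp_bounded_linear[OF assms bounded_linear_plane]
    by (simp_all only: dirderiv_scaled[OF assms] dirderiv_zero[OF assms])
qed

lemma smooth_plane: "smooth H \<Longrightarrow> smooth (\<lambda>z. H (plane \<rho> z))"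
  by (rule smooth_comp_bounded_linear[OF _ bounded_linear_plane])

lemma wave_plane:
  fixes H :: "real \<times> real \<Rightarrow> real"
  assumes "smooth H" "\<And>q. dirderiv (1, 0) (dirderiv (1, 0) H) q
    + \<rho>\<^sup>2 * m * (m - d\<^sup>2) * dirderiv (0, 1) (dirderiv (0, 1) H) q = 0"
  shows "wave (\<lambda>z. H (plane \<rho> z))"
proof -
  have "transport (\<lambda>z. H (plane \<rho> z)) z = 0" for z
    by (simp add: transport_def d_plane assms(1) algebra_simps)
  \<comment> \<open>By the chain rule the second coefficient is \<rho>^2 times m^2 (1 - m c^2) - m
    (m c - d)^2 + 2 m^2 c (m c - d), in which every term with c cancels.\<close>
  moreover have "wave_op (\<lambda>z. H (plane \<rho> z)) z = dirderiv (1, 0) (dirderiv (1, 0) H) (plane \<rho> z)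
      + \<rho>\<^sup>2 * m * (m - d\<^sup>2) * dirderiv (0, 1) (dirderiv (0, 1) H) (plane \<rho> z)" for z
  proof -
    define \<kappa> where "\<kappa> = - \<rho> * (m * c - d)"
    show ?thesis
      unfolding wave_op_def d_plane[OF assms(1)] \<kappa>_def[symmetric]
      by (simp add: d_plane smooth_dirderiv d_cmult smooth_plane assms(1) \<kappa>_def[symmetric] del: mult_minus_left)
        (simp add: \<kappa>_def algebra_simps power2_eq_square)
  qed
  ultimately show ?thesis
    unfolding wave_def using assms by (simp add: smooth_plane d_plane)
qed

text \<open>Such a \<open>K\<close> is constant along the transport field and along the dependent
  variables, so it is determined on the section t = 0. The map \<open>A\<close> parametrises this
  section and is a right inverse of \<open>plane \<rho>\<close>; the function sought is
  \<open>K\<close> after \<open>A\<close>.\<close>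

lemma wave_imp_plane:
  assumes K: "wave K" and \<rho>: "\<rho> \<noteq> 0"
  obtains H :: "real \<times> real \<Rightarrow> real" where "smooth H"
    "\<forall>q. dirderiv (1, 0) (dirderiv (1, 0) H) q + \<rho>\<^sup>2 * m * (m - d\<^sup>2) * dirderiv (0, 1) (dirderiv (0, 1) H) q = 0"
    "K = (\<lambda>z. H (plane \<rho> z))"
proof -
  have sK: "smooth K" and dep: "\<And>\<alpha>. d_dep \<alpha> K = (\<lambda>z. 0)"
    using K by (auto simp: wave_def)
  define A :: "real \<times> real \<Rightarrow> brzr_point" where
    "A = (\<lambda>q. fst q *\<^sub>R pd_x + (snd q / (m * \<rho>)) *\<^sub>R pd_y)"
  have A: "bounded_linear A"
    unfolding A_def divide_inverse
    by (intro bounded_linear_add bounded_linear_scaleR_const bounded_linear_mult_const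
        bounded_linear_fst bounded_linear_snd)
  have "A (1, 0) = pd_x" "A (0, 1) = (1 / (m * \<rho>)) *\<^sub>R pd_y"
    by (simp_all add: A_def)
  then have dx: "dirderiv (1, 0) (\<lambda>q. f (A q)) = (\<lambda>q. d_indep Ix f (A q))"
    and dy: "dirderiv (0, 1) (\<lambda>q. f (A q)) = (\<lambda>q. (1 / (m * \<rho>)) * d_indep Iy f (A q))" if "smooth f" for f :: "brzr_point \<Rightarrow> real"
    unfolding dirderiv_comp_bounded_linear[OF that A] d_indep_def
    by (simp_all only: dirderiv_scaled[OF that] real_scaleR_def)
  have sA: "smooth (\<lambda>q. f (A q))" if "smooth f" for f :: "brzr_point \<Rightarrow> real"
    by (rule smooth_comp_bounded_linear[OF that A])
  \<comment> \<open>The transport equation solved for K_t; substituting it turns the wave equation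
    into one in x and y only.\<close>
  define \<kappa> where "\<kappa> = - (m * c - d) / m"
  have Kt: "d_indep It K = (\<lambda>z. \<kappa> * d_indep Iy K z)"
    using K m by (auto simp: wave_def transport_def fun_eq_iff \<kappa>_def field_simps)
  have Kxx: "d_indep Ix (d_indep Ix K) z + (m - d\<^sup>2) / m * d_indep Iy (d_indep Iy K) z = 0" for z
  proof -
    have Kyt: "d_indep It (d_indep Iy K) z = \<kappa> * d_indep Iy (d_indep Iy K) z"
      by (simp add: d_indep_commute[of _ It Iy] sK Kt d_cmult smooth_d_indep)
    have "d_indep Ix (d_indep Ix K) z + ((1 - m * c\<^sup>2) - m * \<kappa>\<^sup>2 - 2 * m * c * \<kappa>) * d_indep Iy (d_indep Iy K) z = wave_op K z"
      by (simp add: wave_op_def Kt d_cmult sK smooth_d_indep Kyt algebra_simps power2_eq_square)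
    moreover have "(1 - m * c\<^sup>2) - m * \<kappa>\<^sup>2 - 2 * m * c * \<kappa> = (m - d\<^sup>2) / m"
      using m by (simp add: \<kappa>_def field_simps power2_eq_square)
    moreover have "wave_op K z = 0"
      using K unfolding wave_def by blast
    ultimately show ?thesis
      by simp
  qed
  show thesis
  proof (rule that)
    show "smooth (\<lambda>q. K (A q))"
      by (rule sA[OF sK])
    show "\<forall>q. dirderiv (1, 0) (dirderiv (1, 0) (\<lambda>q. K (A q))) q
        + \<rho>\<^sup>2 * m * (m - d\<^sup>2) * dirderiv (0, 1) (dirderiv (0, 1) (\<lambda>q. K (A q))) q = 0"
    proof
      fix q
      have yy: "dirderiv (0, 1) (dirderiv (0, 1) (\<lambda>q. K (A q))) q = 1 / (m * \<rho>) * (1 / (m * \<rho>) * d_indep Iy (d_indep Iy K) (A q))"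
        unfolding dy[OF sK] dirderiv_mult[OF smooth_const sA[OF smooth_d_indep[OF sK]]] dy[OF smooth_d_indep[OF sK]]
        by simp
      have "\<rho>\<^sup>2 * m * (m - d\<^sup>2) * (1 / (m * \<rho>) * (1 / (m * \<rho>) * d_indep Iy (d_indep Iy K) (A q)))
          = (m - d\<^sup>2) / m * d_indep Iy (d_indep Iy K) (A q)"
        using m \<rho> by (simp add: field_simps power2_eq_square)
      then show "dirderiv (1, 0) (dirderiv (1, 0) (\<lambda>q. K (A q))) q
          + \<rho>\<^sup>2 * m * (m - d\<^sup>2) * dirderiv (0, 1) (dirderiv (0, 1) (\<lambda>q. K (A q))) q = 0"
        using Kxx[of "A q"] unfolding yy by (simp add: dx sK smooth_d_indep)
    qed
    show "K = (\<lambda>z. K (A (plane \<rho> z)))"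
    proof
      fix z :: brzr_point
      let ?V = "m *\<^sub>R pd_t + (m * c - d) *\<^sub>R pd_y"
      have V: "dirderiv ?V K z = 0" for z
      proof -
        have "dirderiv ?V K z = transport K z"
          unfolding transport_def d_indep_def dirderiv_sum2[OF sK] dirderiv_scaled[OF sK] real_scaleR_def ..
        then show ?thesis
          using K unfolding wave_def by simp
      qed
      have U: "dirderiv (0, snd z) K = (\<lambda>z. 0)"
        by (simp add: fun_eq_iff dirderiv_expand[OF sK] dep)
      \<comment> \<open>Following the transport field for the parameter -t/m leads to t = 0; then
        the dependent variables are set to 0.\<close>
      have "K z = K (z + (- t_of z / m) *\<^sub>R ?V)"
        by (rule constant_along[OF sK V, symmetric])
      also have "\<dots> = K (z + (- t_of z / m) *\<^sub>R ?V + (- 1) *\<^sub>R (0, snd z))"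
        by (rule constant_along[OF sK, symmetric]) (simp add: U)
      also have "z + (- t_of z / m) *\<^sub>R ?V + (- 1) *\<^sub>R (0, snd z) = A (plane \<rho> z)"
      proof (rule prod_eqI)
        show "fst (z + (- t_of z / m) *\<^sub>R ?V + (- 1) *\<^sub>R (0, snd z)) = fst (A (plane \<rho> z))"
          unfolding vec_eq_iff
        proof
          fix i show "fst (z + (- t_of z / m) *\<^sub>R ?V + (- 1) *\<^sub>R (0, snd z)) $ i = fst (A (plane \<rho> z)) $ i"
            using m \<rho> by (cases i) (simp_all add: A_def plane_def axis_def field_simps)
        qed
      qed (simp add: A_def)
      finally show "K z = K (A (plane \<rho> z))" .
    qed
  qed
qed

end

section \<open>The generators\<close>

definition phi_field :: "(brzr_point \<Rightarrow> real) \<Rightarrow> brzr_field" where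
  "phi_field K = (\<lambda>z. K z *\<^sub>R pd_phi)"

lemma all_indep: "(\<forall>i. P i) \<longleftrightarrow> P Ix \<and> P Iy \<and> P It"
  by (metis indep.exhaust)

lemma all_dep: "(\<forall>\<alpha>. P \<alpha>) \<longleftrightarrow> P Du \<and> P Dv \<and> P Dphi"
  by (metis dep.exhaust)

lemma field_eq_iff:
  "X = Y \<longleftrightarrow> (\<forall>z. fst (X z) = fst (Y z) \<and> snd (X z) $ Du = snd (Y z) $ Du
     \<and> snd (X z) $ Dv = snd (Y z) $ Dv \<and> snd (X z) $ Dphi = snd (Y z) $ Dphi)"
  for X Y :: brzr_field
  unfolding fun_eq_iff prod_eq_iff vec_eq_iff[of "snd _"] all_dep by simp

lemmas generator_defs = \<X>\<^sub>1_def \<X>\<^sub>2_def \<X>\<^sub>3_def \<X>\<^sub>4_def \<X>\<^sub>5_def \<X>\<^sub>6_def phi_field_def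

lemma sym_field_add: "sym_field k B h + sym_field k' B' h' = sym_field (k + k') (\<lambda>z. B z + B' z) (\<lambda>z. h z + h' z)"
  by (simp add: field_eq_iff algebra_simps)

lemma sym_field_scaleR: "x *\<^sub>R sym_field k B h = sym_field (x *\<^sub>R k) (\<lambda>z. x * B z) (\<lambda>z. x * h z)"
  by (simp add: field_eq_iff scaleR_fun_def algebra_simps)

lemma phi_field_sym_field: "phi_field K = sym_field 0 (\<lambda>z. 0) K"
  by (simp add: field_eq_iff phi_field_def axis_def)

lemma translations_sym_field:
  "\<X>\<^sub>1 = sym_field (axis It 1) (\<lambda>z. 0) (\<lambda>z. 0)"
  "\<X>\<^sub>2 = sym_field (axis Ix 1) (\<lambda>z. 0) (\<lambda>z. 0)"
  "\<X>\<^sub>3 = sym_field (axis Iy 1) (\<lambda>z. 0) (\<lambda>z. 0)"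
  by (simp_all add: field_eq_iff generator_defs)

lemma vec_indep: "k = k $ Ix *\<^sub>R axis Ix 1 + k $ Iy *\<^sub>R axis Iy 1 + k $ It *\<^sub>R axis It (1::real)"
  by (simp add: vec_eq_iff all_indep axis_def)

context brzr
begin

definition quadratic_field :: "real \<Rightarrow> real \<Rightarrow> real \<Rightarrow> brzr_field" where
  "quadratic_field \<beta>\<^sub>0 \<beta>\<^sub>1 \<beta>\<^sub>2 = sym_field 0 (\<lambda>z. \<beta>\<^sub>0 + \<beta>\<^sub>1 * t_of z + \<beta>\<^sub>2 * (t_of z * t_of z))
     (\<lambda>z. (1 / (m * w)) * (\<beta>\<^sub>0 + \<beta>\<^sub>1 * t_of z + \<beta>\<^sub>2 * (t_of z * t_of z)) + (\<beta>\<^sub>2 / w) * (x_of z * x_of z))"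

lemma rotations_quadratic:
  "\<X>\<^sub>4 m w = quadratic_field 1 0 0" "\<X>\<^sub>5 m w = quadratic_field 0 1 0" "\<X>\<^sub>6 m w = quadratic_field 0 0 1"
  by (simp_all add: field_eq_iff generator_defs quadratic_field_def axis_def power2_eq_square)

lemma quadratic_field_decomp:
  "quadratic_field \<beta>\<^sub>0 \<beta>\<^sub>1 \<beta>\<^sub>2 = \<beta>\<^sub>0 *\<^sub>R \<X>\<^sub>4 m w + \<beta>\<^sub>1 *\<^sub>R \<X>\<^sub>5 m w + \<beta>\<^sub>2 *\<^sub>R \<X>\<^sub>6 m w"
  unfolding rotations_quadratic
  by (simp add: field_eq_iff quadratic_field_def scaleR_fun_def algebra_simps add_divide_distrib)

lemma LSA_iff: "X \<in> LSA \<longleftrightarrow> (\<exists>k B h. admissible B h \<and> X = sym_field k B h)"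
  using LSA_imp_sym_field sym_field_in_LSA by blast

lemma admissible_0: "admissible (\<lambda>z. 0) (\<lambda>z. 0)"
  by (simp add: admissible_def transport_def wave_op_def)

lemma subspace_LSA: "subspace LSA"
proof (rule subspaceI)
  have "(0 :: brzr_field) = sym_field 0 (\<lambda>z. 0) (\<lambda>z. 0)"
    by (simp add: field_eq_iff)
  then show "0 \<in> LSA"
    using admissible_0 LSA_iff by blast
  show "X + Y \<in> LSA" if "X \<in> LSA" "Y \<in> LSA" for X Y
    using that admissible_add unfolding LSA_iff by (metis sym_field_add)
  show "x *\<^sub>R X \<in> LSA" if "X \<in> LSA" for x X
    using that admissible_cmult unfolding LSA_iff by (metis sym_field_scaleR)
qed

lemma generators_in_LSA: "{\<X>\<^sub>1, \<X>\<^sub>2, \<X>\<^sub>3, \<X>\<^sub>4 m w, \<X>\<^sub>5 m w, \<X>\<^sub>6 m w} \<subseteq> LSA"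
proof -
  have "quadratic_field \<beta>\<^sub>0 \<beta>\<^sub>1 \<beta>\<^sub>2 \<in> LSA" for \<beta>\<^sub>0 \<beta>\<^sub>1 \<beta>\<^sub>2
    unfolding quadratic_field_def by (rule sym_field_in_LSA[OF admissible_quadratic])
  then show ?thesis
    using sym_field_in_LSA[OF admissible_0] by (simp add: translations_sym_field rotations_quadratic)
qed

lemma phi_field_in_LSA: "wave K \<Longrightarrow> phi_field K \<in> LSA"
  by (simp add: phi_field_sym_field sym_field_in_LSA admissible_0_iff)

lemma LSA_decomp:
  assumes "X \<in> LSA"
  obtains k \<beta>\<^sub>0 \<beta>\<^sub>1 \<beta>\<^sub>2 K where "wave K"
    "X = k $ Ix *\<^sub>R \<X>\<^sub>2 + k $ Iy *\<^sub>R \<X>\<^sub>3 + k $ It *\<^sub>R \<X>\<^sub>1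
      + (\<beta>\<^sub>0 *\<^sub>R \<X>\<^sub>4 m w + \<beta>\<^sub>1 *\<^sub>R \<X>\<^sub>5 m w + \<beta>\<^sub>2 *\<^sub>R \<X>\<^sub>6 m w) + phi_field K"
proof -
  obtain k B h where Bh: "admissible B h" and X: "X = sym_field k B h"
    using assms LSA_iff by blast
  from Bh obtain \<beta>\<^sub>0 \<beta>\<^sub>1 \<beta>\<^sub>2 K where K: "wave K"
    and B: "B = (\<lambda>z. \<beta>\<^sub>0 + \<beta>\<^sub>1 * t_of z + \<beta>\<^sub>2 * (t_of z * t_of z))"
    and h: "h = (\<lambda>z. (1 / (m * w)) * (\<beta>\<^sub>0 + \<beta>\<^sub>1 * t_of z + \<beta>\<^sub>2 * (t_of z * t_of z)) + (\<beta>\<^sub>2 / w) * (x_of z * x_of z) + K z)"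
    by (rule admissible_cases)
  have "X = sym_field (k $ Ix *\<^sub>R axis Ix 1 + k $ Iy *\<^sub>R axis Iy 1 + k $ It *\<^sub>R axis It 1) (\<lambda>z. 0) (\<lambda>z. 0)
      + quadratic_field \<beta>\<^sub>0 \<beta>\<^sub>1 \<beta>\<^sub>2 + phi_field K"
    unfolding X vec_indep[symmetric] quadratic_field_def phi_field_sym_field sym_field_add B h by simp
  also have "sym_field (k $ Ix *\<^sub>R axis Ix 1 + k $ Iy *\<^sub>R axis Iy 1 + k $ It *\<^sub>R axis It 1) (\<lambda>z. 0) (\<lambda>z. 0)
      = k $ Ix *\<^sub>R \<X>\<^sub>2 + k $ Iy *\<^sub>R \<X>\<^sub>3 + k $ It *\<^sub>R \<X>\<^sub>1"
    unfolding translations_sym_field sym_field_scaleR sym_field_add by simp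
  finally show thesis
    using that[OF K] unfolding quadratic_field_decomp by blast
qed

text \<open>Translations and the quadratic phase rates are already accounted for by the six
  generators, so each case only has to span the shifts of phi.\<close>

lemma LSA_eq_span:
  assumes W: "W \<subseteq> LSA" and span: "\<And>K. wave K \<Longrightarrow> phi_field K \<in> span W"
  shows "LSA = span ({\<X>\<^sub>1, \<X>\<^sub>2, \<X>\<^sub>3, \<X>\<^sub>4 m w, \<X>\<^sub>5 m w, \<X>\<^sub>6 m w} \<union> W)" (is "_ = span (?G \<union> W)")
proof
  show "span (?G \<union> W) \<subseteq> LSA"
    using W generators_in_LSA by (intro span_minimal subspace_LSA) blast
  show "LSA \<subseteq> span (?G \<union> W)"
  proof
    fix X assume "X \<in> LSA"
    then obtain k \<beta>\<^sub>0 \<beta>\<^sub>1 \<beta>\<^sub>2 K where K: "wave K" and X: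
      "X = k $ Ix *\<^sub>R \<X>\<^sub>2 + k $ Iy *\<^sub>R \<X>\<^sub>3 + k $ It *\<^sub>R \<X>\<^sub>1
        + (\<beta>\<^sub>0 *\<^sub>R \<X>\<^sub>4 m w + \<beta>\<^sub>1 *\<^sub>R \<X>\<^sub>5 m w + \<beta>\<^sub>2 *\<^sub>R \<X>\<^sub>6 m w) + phi_field K"
      by (rule LSA_decomp)
    have "phi_field K \<in> span (?G \<union> W)"
      using span[OF K] span_mono[of W "?G \<union> W"] by blast
    then show "X \<in> span (?G \<union> W)"
      unfolding X by (intro span_add span_scale) (auto intro: span_base)
  qed
qed

section \<open>The shifts of phi in the hyperbolic, elliptic and degenerate case\<close>

lemma case_A:
  assumes "m < d\<^sup>2"
  shows "{\<P>\<^sub>A c d m F |F. smooth F} \<union> {\<Q>\<^sub>A c d m G |G. smooth G} \<subseteq> LSA" (is "?W \<subseteq> LSA")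
    and "wave K \<Longrightarrow> phi_field K \<in> span ({\<P>\<^sub>A c d m F |F. smooth F} \<union> {\<Q>\<^sub>A c d m G |G. smooth G})"
proof -
  define \<gamma> where "\<gamma> = sqrt (m * (d\<^sup>2 - m))"
  have \<gamma>: "\<gamma> > 0" "\<gamma>\<^sup>2 = m * (d\<^sup>2 - m)"
    using assms m by (simp_all add: \<gamma>_def)
  \<comment> \<open>A travelling wave in either direction, \<sigma> = 1 or \<sigma> = -1: the
    equation is H_xx = \<gamma>^2 H_ss.\<close>
  have wave: "wave (\<lambda>z. F (\<gamma> * fst (plane 1 z) + \<sigma> * snd (plane 1 z)))"
    if F: "smooth F" and \<sigma>: "\<sigma>\<^sup>2 = 1" for F :: "real \<Rightarrow> real" and \<sigma>
  proof -
    have bl: "bounded_linear (\<lambda>q. \<gamma> * fst q + \<sigma> * snd q)"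
      by (intro bounded_linear_add bounded_linear_const_mult bounded_linear_fst bounded_linear_snd)
    have D: "dirderiv v (\<lambda>q. F (\<gamma> * fst q + \<sigma> * snd q))
        = (\<lambda>q. (\<gamma> * fst v + \<sigma> * snd v) * dirderiv 1 F (\<gamma> * fst q + \<sigma> * snd q))"
      if "smooth F" for v and F :: "real \<Rightarrow> real"
      unfolding dirderiv_comp_bounded_linear[OF that bl]
      by (subst dirderiv_real[OF that]) simp
    have sm: "smooth (\<lambda>q. F (\<gamma> * fst q + \<sigma> * snd q))" if "smooth F" for F :: "real \<Rightarrow> real"
      by (rule smooth_comp_bounded_linear[OF that bl])
    have DD: "dirderiv v (dirderiv v (\<lambda>q. F (\<gamma> * fst q + \<sigma> * snd q))) q
        = (\<gamma> * fst v + \<sigma> * snd v)\<^sup>2 * dirderiv 1 (dirderiv 1 F) (\<gamma> * fst q + \<sigma> * snd q)" for v q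
      unfolding D[OF F] dirderiv_mult[OF smooth_const sm[OF smooth_dirderiv[OF F]]] D[OF smooth_dirderiv[OF F]]
      by (simp add: power2_eq_square)
    show ?thesis
      by (rule wave_plane[OF sm[OF F]]) (simp add: DD \<gamma> \<sigma> algebra_simps)
  qed
  have P: "\<P>\<^sub>A c d m F = phi_field (\<lambda>z. F (\<gamma> * fst (plane 1 z) + (- 1) * snd (plane 1 z)))"
    and Q: "\<Q>\<^sub>A c d m F = phi_field (\<lambda>z. F (\<gamma> * fst (plane 1 z) + 1 * snd (plane 1 z)))" for F
    by (simp_all add: \<P>\<^sub>A_def \<Q>\<^sub>A_def phi_field_def plane_def \<gamma>_def algebra_simps)
  show "?W \<subseteq> LSA"
    unfolding P Q by (auto intro!: phi_field_in_LSA wave[of _ 1, simplified] wave[of _ "- 1", simplified])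
  assume K: "wave K"
  obtain H where H: "smooth H"
    "\<forall>q. dirderiv (1, 0) (dirderiv (1, 0) H) q + 1\<^sup>2 * m * (m - d\<^sup>2) * dirderiv (0, 1) (dirderiv (0, 1) H) q = 0"
    "K = (\<lambda>z. H (plane 1 z))"
    by (rule wave_imp_plane[OF K one_neq_zero])
  \<comment> \<open>The basis dual to the characteristic coordinates: (x, s) = (\<gamma> x - s)
    \<open>v\<^sub>1\<close> + (\<gamma> x + s) \<open>v\<^sub>2\<close>. The mixed derivative along
    it is p^2 (H_xx - \<gamma>^2 H_ss), which vanishes.\<close>
  define p where "p = 1 / (2 * \<gamma>)"
  define v\<^sub>1 v\<^sub>2 :: "real \<times> real" where "v\<^sub>1 = p *\<^sub>R (1, 0) + (- 1 / 2) *\<^sub>R (0, 1)" and "v\<^sub>2 = p *\<^sub>R (1, 0) + (1 / 2) *\<^sub>R (0, 1)"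
  have lin: "dirderiv (p *\<^sub>R (1, 0) + x *\<^sub>R (0, 1)) f = (\<lambda>q. p * dirderiv (1, 0) f q + x * dirderiv (0, 1) f q)"
    if "smooth f" for f :: "real \<times> real \<Rightarrow> real" and x
    by (simp only: dirderiv_sum2[OF that] dirderiv_scaled[OF that] real_scaleR_def fun_eq_iff simp_thms)
  have "dirderiv v\<^sub>1 (dirderiv v\<^sub>2 H) q = 0" for q
  proof -
    have "dirderiv v\<^sub>1 (dirderiv v\<^sub>2 H) q = p * dirderiv (1, 0) (dirderiv v\<^sub>2 H) q + (- 1 / 2) * dirderiv (0, 1) (dirderiv v\<^sub>2 H) q"
      unfolding v\<^sub>1_def by (simp only: lin[OF smooth_dirderiv[OF H(1)]])
    also have "\<dots> = p * (p * dirderiv (1, 0) (dirderiv (1, 0) H) q + (1 / 2) * dirderiv (1, 0) (dirderiv (0, 1) H) q)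
        + (- 1 / 2) * (p * dirderiv (0, 1) (dirderiv (1, 0) H) q + (1 / 2) * dirderiv (0, 1) (dirderiv (0, 1) H) q)"
      unfolding v\<^sub>2_def dirderiv_commute[OF H(1), of _ "p *\<^sub>R (1, 0) + (1 / 2) *\<^sub>R (0, 1)"]
      by (simp only: lin[OF smooth_dirderiv[OF H(1)]] dirderiv_commute[OF H(1), of "(1, 0)" "(0, 1)"])
    also have "\<dots> = p\<^sup>2 * (dirderiv (1, 0) (dirderiv (1, 0) H) q - \<gamma>\<^sup>2 * dirderiv (0, 1) (dirderiv (0, 1) H) q)"
      using \<gamma>(1) by (simp add: p_def dirderiv_commute[OF H(1), of "(1, 0)" "(0, 1)"] field_simps power2_eq_square)
    also have "\<dots> = 0"
      using H(2)[rule_format, of q] unfolding \<gamma>(2) by (simp add: algebra_simps)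
    finally show ?thesis .
  qed
  then have split: "H (s *\<^sub>R v\<^sub>1 + t *\<^sub>R v\<^sub>2) = H (s *\<^sub>R v\<^sub>1) + H (t *\<^sub>R v\<^sub>2) - H 0" for s t
    by (intro dalembert[OF H(1)]) auto
  define F where "F = (\<lambda>s::real. H (s *\<^sub>R v\<^sub>1))"
  define G where "G = (\<lambda>t::real. H (t *\<^sub>R v\<^sub>2) - H 0)"
  have FG: "smooth F" "smooth G"
    unfolding F_def G_def
    by (intro smooth_diff smooth_const smooth_comp_bounded_linear[OF H(1)] bounded_linear_scaleR_left)+
  have "K z = F (\<gamma> * fst (plane 1 z) + (- 1) * snd (plane 1 z)) + G (\<gamma> * fst (plane 1 z) + 1 * snd (plane 1 z))" for z
  proof -
    obtain x s where xs: "plane 1 z = (x, s)"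
      by (cases "plane 1 z")
    have "(\<gamma> * x - s) *\<^sub>R v\<^sub>1 + (\<gamma> * x + s) *\<^sub>R v\<^sub>2 = (x, s)"
      using \<gamma>(1) by (simp add: v\<^sub>1_def v\<^sub>2_def p_def field_simps)
    then show ?thesis
      using split[of "\<gamma> * x - s" "\<gamma> * x + s"] by (simp add: H(3) xs F_def G_def)
  qed
  then have K: "phi_field K = \<P>\<^sub>A c d m F + \<Q>\<^sub>A c d m G"
    unfolding P Q by (simp add: phi_field_def fun_eq_iff scaleR_add_left)
  show "phi_field K \<in> span ?W"
    unfolding K using FG by (intro span_add span_base) blast+
qed

lemma case_B:
  assumes "m > d\<^sup>2"
  shows "{\<P>\<^sub>B c d m H |H. harmonic H} \<subseteq> LSA"
    and "wave K \<Longrightarrow> phi_field K \<in> span {\<P>\<^sub>B c d m H |H. harmonic H}"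
proof -
  define \<rho> where "\<rho> = 1 / sqrt (m * (m - d\<^sup>2))"
  have \<rho>: "\<rho> \<noteq> 0" "\<rho>\<^sup>2 * m * (m - d\<^sup>2) = 1"
    using assms m by (simp_all add: \<rho>_def power_divide)
  have P: "\<P>\<^sub>B c d m H = phi_field (\<lambda>z. H (plane \<rho> z))" for H
    by (simp add: \<P>\<^sub>B_def phi_field_def plane_def \<rho>_def)
  show "{\<P>\<^sub>B c d m H |H. harmonic H} \<subseteq> LSA"
    unfolding P using \<rho> by (auto intro!: phi_field_in_LSA wave_plane simp: harmonic_iff)
  assume K: "wave K"
  obtain H where H: "smooth H"
    "\<forall>q. dirderiv (1, 0) (dirderiv (1, 0) H) q + \<rho>\<^sup>2 * m * (m - d\<^sup>2) * dirderiv (0, 1) (dirderiv (0, 1) H) q = 0"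
    "K = (\<lambda>z. H (plane \<rho> z))"
    by (rule wave_imp_plane[OF K \<rho>(1)])
  then have "harmonic H"
    using \<rho>(2) by (simp add: harmonic_iff)
  then show "phi_field K \<in> span {\<P>\<^sub>B c d m H |H. harmonic H}"
    unfolding P H(3) by (auto intro: span_base)
qed

lemma case_C:
  assumes md: "m = d\<^sup>2"
  shows "{\<P>\<^sub>C c d R |R. smooth R} \<union> {\<Q>\<^sub>C c d S |S. smooth S} \<subseteq> LSA" (is "?W \<subseteq> LSA")
    and "wave K \<Longrightarrow> phi_field K \<in> span ({\<P>\<^sub>C c d R |R. smooth R} \<union> {\<Q>\<^sub>C c d S |S. smooth S})"
proof -
  have snd_plane: "snd (plane (1 / d) z) = d * y_of z - (c * d - 1) * t_of z" for z
    using d unfolding plane_def by (simp add: md field_simps power2_eq_square)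
  have P: "\<P>\<^sub>C c d R = phi_field (\<lambda>z. fst (plane (1 / d) z) * R (snd (plane (1 / d) z)))"
    and Q: "\<Q>\<^sub>C c d R = phi_field (\<lambda>z. R (snd (plane (1 / d) z)))" for R
    unfolding snd_plane by (simp_all add: \<P>\<^sub>C_def \<Q>\<^sub>C_def phi_field_def plane_def)
  have smR: "smooth (\<lambda>q::real \<times> real. R (snd q))" and DR: "dirderiv (1, 0) (\<lambda>q. R (snd q)) = (\<lambda>q. 0)"
    if "smooth R" for R :: "real \<Rightarrow> real"
  proof -
    show "smooth (\<lambda>q::real \<times> real. R (snd q))"
      by (rule smooth_comp_bounded_linear[OF that bounded_linear_snd])
    show "dirderiv (1, 0) (\<lambda>q. R (snd q)) = (\<lambda>q. 0)"
      unfolding dirderiv_comp_bounded_linear[OF that bounded_linear_snd] by (simp add: dirderiv_zero[OF that])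
  qed
  have fst: "smooth (fst :: real \<times> real \<Rightarrow> real)" "dirderiv (1, 0) (fst :: real \<times> real \<Rightarrow> real) = (\<lambda>q. 1)"
    by (simp_all add: smooth_bounded_linear bounded_linear_fst dirderiv_bounded_linear[OF bounded_linear_fst])
  have "wave (\<lambda>z. fst (plane (1 / d) z) * R (snd (plane (1 / d) z)))" if R: "smooth R" for R :: "real \<Rightarrow> real"
    using wave_plane[of "\<lambda>q. fst q * R (snd q)" "1 / d"] R fst
    by (simp add: smooth_mult smR dirderiv_mult DR md)
  moreover have "wave (\<lambda>z. R (snd (plane (1 / d) z)))" if R: "smooth R" for R :: "real \<Rightarrow> real"
    using wave_plane[of "\<lambda>q. R (snd q)" "1 / d"] R by (simp add: smR DR md)
  ultimately show "?W \<subseteq> LSA"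
    unfolding P Q by (auto intro: phi_field_in_LSA)
  assume "wave K"
  moreover have "1 / d \<noteq> 0"
    using d by simp
  ultimately obtain H where H: "smooth H"
    "\<forall>q. dirderiv (1, 0) (dirderiv (1, 0) H) q + (1 / d)\<^sup>2 * m * (m - d\<^sup>2) * dirderiv (0, 1) (dirderiv (0, 1) H) q = 0"
    "K = (\<lambda>z. H (plane (1 / d) z))"
    by (rule wave_imp_plane)
  \<comment> \<open>For m = d^2 the equation is H_xx = 0, so H is affine in x: the slope at x = 0 is
    R and the value there is S.\<close>
  define R where "R = (\<lambda>s::real. dirderiv (1, 0) H (s *\<^sub>R (0, 1)))"
  define S where "S = (\<lambda>s::real. H (s *\<^sub>R (0, 1)))"
  have RS: "smooth R" "smooth S"
    unfolding R_def S_def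
    by (rule smooth_comp_bounded_linear[OF smooth_dirderiv[OF H(1)] bounded_linear_scaleR_left]
        smooth_comp_bounded_linear[OF H(1) bounded_linear_scaleR_left])+
  have "H (x, s) = x * R s + S s" for x s
    using affine_along[OF H(1), of "(1, 0)" "(0, s)" x] H(2) by (simp add: fun_eq_iff md R_def S_def)
  then have "H q = fst q * R (snd q) + S (snd q)" for q
    using prod.collapse[of q] by metis
  then have K: "phi_field K = \<P>\<^sub>C c d R + \<Q>\<^sub>C c d S"
    unfolding P Q H(3) by (simp add: phi_field_def fun_eq_iff scaleR_add_left)
  show "phi_field K \<in> span ?W"
    unfolding K using RS by (intro span_add span_base) blast+
qed

end

section \<open>Infinite dimension\<close>

lemma smooth_exp: "smooth (\<lambda>s::real. exp (\<kappa> * s))"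
proof (rule smooth_coinduct[where P = "\<lambda>f. \<exists>A. f = (\<lambda>s. A * exp (\<kappa> * s))"])
  fix f :: "real \<Rightarrow> real" assume "\<exists>A. f = (\<lambda>s. A * exp (\<kappa> * s))"
  then obtain A where f: "f = (\<lambda>s. A * exp (\<kappa> * s))" by blast
  have D: "(f has_derivative (\<lambda>v. (A * \<kappa> * v) * exp (\<kappa> * s))) (at s)" for s
    unfolding f by (auto intro!: derivative_eq_intros simp: algebra_simps)
  have "dirderiv v f = (\<lambda>s. (A * \<kappa> * v) * exp (\<kappa> * s))" for v
    using dirderiv_eqI[OF D] by (simp add: fun_eq_iff)
  then show "(\<forall>x. f differentiable at x) \<and> (\<forall>v. \<exists>A. dirderiv v f = (\<lambda>s. A * exp (\<kappa> * s)))"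
    using D by (blast intro: differentiableI)
qed (auto intro: exI[of _ 1])

lemma smooth_cos: "smooth (\<lambda>s::real. cos (\<kappa> * s))"
proof (rule smooth_coinduct[where P = "\<lambda>f. \<exists>A B. f = (\<lambda>s. A * cos (\<kappa> * s) + B * sin (\<kappa> * s))"])
  fix f :: "real \<Rightarrow> real" assume "\<exists>A B. f = (\<lambda>s. A * cos (\<kappa> * s) + B * sin (\<kappa> * s))"
  then obtain A B where f: "f = (\<lambda>s. A * cos (\<kappa> * s) + B * sin (\<kappa> * s))" by blast
  have D: "(f has_derivative (\<lambda>v. (B * \<kappa> * v) * cos (\<kappa> * s) + (- A * \<kappa> * v) * sin (\<kappa> * s))) (at s)" for s
    unfolding f by (auto intro!: derivative_eq_intros simp: algebra_simps)
  have "dirderiv v f = (\<lambda>s. (B * \<kappa> * v) * cos (\<kappa> * s) + (- A * \<kappa> * v) * sin (\<kappa> * s))" for v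
    using dirderiv_eqI[OF D] by (simp add: fun_eq_iff)
  then show "(\<forall>x. f differentiable at x) \<and>
      (\<forall>v. \<exists>A B. dirderiv v f = (\<lambda>s. A * cos (\<kappa> * s) + B * sin (\<kappa> * s)))"
    using D by (blast intro: differentiableI)
qed (rule exI[of _ 1], rule exI[of _ 0], simp)

text \<open>The real part of exp(\<kappa> (x + i s)). On s = 0 it is the exponential needed for the
  independence argument.\<close>

lemma harmonic_exp_cos: "harmonic (\<lambda>q. exp (\<kappa> * fst q) * cos (\<kappa> * snd q))"
proof -
  have "deriv (\<lambda>x. exp (\<kappa> * x) * C) = (\<lambda>x. exp (\<kappa> * x) * (\<kappa> * C))" for C
    by (intro ext DERIV_imp_deriv) (auto intro!: derivative_eq_intros)
  moreover have "deriv (\<lambda>s. C * cos (\<kappa> * s)) = (\<lambda>s. (- C * \<kappa>) * sin (\<kappa> * s))"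
    "deriv (\<lambda>s. C * sin (\<kappa> * s)) = (\<lambda>s. (C * \<kappa>) * cos (\<kappa> * s))" for C
    by (intro ext DERIV_imp_deriv; auto intro!: derivative_eq_intros)+
  moreover have "smooth (\<lambda>q::real \<times> real. exp (\<kappa> * fst q) * cos (\<kappa> * snd q))"
    by (intro smooth_mult smooth_comp_bounded_linear[OF smooth_exp bounded_linear_fst]
        smooth_comp_bounded_linear[OF smooth_cos bounded_linear_snd])
  ultimately show ?thesis
    unfolding harmonic_def by (simp only: fst_conv snd_conv simp_thms) (simp add: algebra_simps)
qed

text \<open>With s = ln x the sum becomes a polynomial in x that vanishes on the whole positive
  half-line, hence identically.\<close>

lemma exponentials_independent:
  fixes C :: "nat \<Rightarrow> real"
  assumes "finite S" "\<And>s. (\<Sum>k\<in>S. C k * exp (real k * s)) = 0" "k \<in> S"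
  shows "C k = 0"
proof -
  define p where "p = (\<Sum>k\<in>S. monom (C k) k)"
  have "poly p x = 0" if "x > 0" for x
  proof -
    have "poly p x = (\<Sum>k\<in>S. C k * exp (real k * ln x))"
      using that by (simp add: p_def poly_sum poly_monom exp_of_nat_mult)
    then show ?thesis
      using assms(2) by simp
  qed
  then have "{0<..} \<subseteq> {x. poly p x = 0}"
    by auto
  then have "p = 0"
    using poly_roots_finite[of p] infinite_Ioi[of "0::real"] finite_subset by blast
  then have "coeff p k = 0"
    by simp
  then show ?thesis
    using assms(1,3) by (simp add: p_def coeff_sum)
qed

text \<open>Reading off the phi-component at a point of the path \<open>P\<close> is linear, so a
  dependence among the fields would be one among exponentials. An infinite independent family does
  not fit into the span of a finite set.\<close>

lemma infinite_dimensionalI: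
  fixes L :: "brzr_field set"
  assumes X: "\<And>k::nat. X k \<in> L" and P: "\<And>k s. snd (X k (P s)) $ Dphi = exp (real k * s)"
  shows "infinite_dimensional L"
  unfolding infinite_dimensional_def
proof
  assume "\<exists>B. finite B \<and> L \<subseteq> span B"
  then obtain B where B: "finite B" "L \<subseteq> span B" by blast
  have inj: "inj X"
  proof (rule injI)
    fix k l assume "X k = X l"
    then have "exp (real k * 1) = exp (real l * 1)"
      using P by metis
    then show "k = l" by simp
  qed
  have lin: "linear (\<lambda>Y::brzr_field. snd (Y z) $ Dphi)" for z
    by (rule linearI) (simp_all add: scaleR_fun_def)
  have "independent (range X)"
    unfolding independent_explicit_module
  proof (intro allI impI)
    fix T u Y assume T: "finite T" "T \<subseteq> range X" "(\<Sum>Y\<in>T. u Y *\<^sub>R Y) = 0" "Y \<in> T"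
    define S where "S = X -` T"
    have TS: "T = X ` S" "finite S"
      using T(1,2) inj by (auto simp: S_def intro: finite_vimageI)
    have "(\<Sum>k\<in>S. u (X k) * exp (real k * s)) = 0" for s
    proof -
      have "(\<Sum>k\<in>S. u (X k) * exp (real k * s)) = (\<Sum>Y\<in>T. u Y * (snd (Y (P s)) $ Dphi))"
        unfolding TS(1) using inj by (subst sum.reindex) (auto intro: inj_on_subset simp: P)
      also have "\<dots> = snd ((\<Sum>Y\<in>T. u Y *\<^sub>R Y) (P s)) $ Dphi"
        by (simp add: linear_sum[OF lin] scaleR_fun_def)
      finally show ?thesis
        using T(3) by simp
    qed
    moreover obtain k where "k \<in> S" "Y = X k"
      using T(4) TS(1) by blast
    ultimately show "u Y = 0"
      using exponentials_independent[of S "\<lambda>k. u (X k)"] TS(2) by blast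
  qed
  then have "finite (range X)"
    using independent_span_bound[OF B(1)] X B(2) by blast
  then show False
    using inj finite_imageD by blast
qed

lemma (in brzr) infinite_dimensional_LSA: "infinite_dimensional LSA"
proof (cases m "d\<^sup>2" rule: linorder_cases)
  case less
  have "\<P>\<^sub>A c d m (\<lambda>s. exp (real k * s)) \<in> LSA" for k
    using case_A(1)[OF less] smooth_exp by blast
  then show ?thesis
    \<comment> \<open>On this path x = t = 0 and the argument -m y of F equals s.\<close>
    by (rule infinite_dimensionalI[where X = "\<lambda>k. \<P>\<^sub>A c d m (\<lambda>s. exp (real k * s))"
        and P = "\<lambda>s. (axis Iy (- s / m), 0)"])
      (use m in \<open>simp add: \<P>\<^sub>A_def axis_def\<close>)
next
  case greater
  have "\<P>\<^sub>B c d m (\<lambda>q. exp (real k * fst q) * cos (real k * snd q)) \<in> LSA" for k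
    using case_B(1)[OF greater] harmonic_exp_cos by blast
  then show ?thesis
    \<comment> \<open>On this path y = t = 0, so the cosine is 1 and exp(k x) with x = s
      remains.\<close>
    by (rule infinite_dimensionalI[where X = "\<lambda>k. \<P>\<^sub>B c d m (\<lambda>q. exp (real k * fst q) * cos (real k * snd q))"
        and P = "\<lambda>s. (axis Ix s, 0)"])
      (simp add: \<P>\<^sub>B_def axis_def)
next
  case equal
  have "\<Q>\<^sub>C c d (\<lambda>s. exp (real k * s)) \<in> LSA" for k
    using case_C(1)[OF equal] smooth_exp by blast
  then show ?thesis
    by (rule infinite_dimensionalI[where X = "\<lambda>k. \<Q>\<^sub>C c d (\<lambda>s. exp (real k * s))"
        and P = "\<lambda>s. (axis Iy (s / d), 0)"])
      (use d in \<open>simp add: \<Q>\<^sub>C_def axis_def\<close>)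
qed

theorem proposition2p2:
  fixes a b c \<epsilon>\<^sub>0 d m w :: real
  assumes "a \<noteq> 0" and "b \<noteq> 0" and "c \<noteq> 0"
    and "\<epsilon>\<^sub>0 > 0" and "d > 0" and "m > 0" and "w > 0"
  shows "infinite_dimensional (lie_symmetry_algebra (brzr_system a b c \<epsilon>\<^sub>0 d m w))
    \<and> (m < d\<^sup>2 \<longrightarrow>
        lie_symmetry_algebra (brzr_system a b c \<epsilon>\<^sub>0 d m w) =
          span ({\<X>\<^sub>1, \<X>\<^sub>2, \<X>\<^sub>3, \<X>\<^sub>4 m w, \<X>\<^sub>5 m w, \<X>\<^sub>6 m w}
            \<union> {\<P>\<^sub>A c d m F |F. smooth F} \<union> {\<Q>\<^sub>A c d m G |G. smooth G}))
    \<and> (m > d\<^sup>2 \<longrightarrow>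
        lie_symmetry_algebra (brzr_system a b c \<epsilon>\<^sub>0 d m w) =
          span ({\<X>\<^sub>1, \<X>\<^sub>2, \<X>\<^sub>3, \<X>\<^sub>4 m w, \<X>\<^sub>5 m w, \<X>\<^sub>6 m w}
            \<union> {\<P>\<^sub>B c d m H |H. harmonic H}))
    \<and> (m = d\<^sup>2 \<longrightarrow>
        lie_symmetry_algebra (brzr_system a b c \<epsilon>\<^sub>0 d m w) =
          span ({\<X>\<^sub>1, \<X>\<^sub>2, \<X>\<^sub>3, \<X>\<^sub>4 m w, \<X>\<^sub>5 m w, \<X>\<^sub>6 m w}
            \<union> {\<P>\<^sub>C c d R |R. smooth R} \<union> {\<Q>\<^sub>C c d S |S. smooth S}))"
proof -
  interpret brzr a b c \<epsilon>\<^sub>0 d m w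
    using assms by unfold_locales
  show ?thesis
    using infinite_dimensional_LSA LSA_eq_span[OF case_A] LSA_eq_span[OF case_B] LSA_eq_span[OF case_C]
    unfolding Un_assoc by blast
qed

end
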